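(* Let $n\ge 1$ and $r\ge 1$ be integers and let $K$ be a commutative ring containing an invertible element $\varepsilon$. Let $H=\mathcal H_{\vartriangle}(r)_K$ be the extended affine Hecke algebra of type $A$ with Hecke parameter $\varepsilon$, and let $S=\mathcal S_{\vartriangle}(n,r)_K=\operatorname{End}_{H}\bigl(\bigoplus_{\lambda\in\Lambda_{\vartriangle}(n,r)}x_\lambda H\bigr)$ be the affine quantum Schur algebra. Then the natural $K$-algebra homomorphism $$\xi_r: H\longrightarrow \operatorname{End}_{S}\Bigl(\bigoplus_{\lambda\in\Lambda_{\vartriangle}(n,r)}x_\lambda H\Bigr)^{\mathrm{op}},\qquad \xi_r(h)(t)=th,$$ is injective.
   Context: Extended affine symmetric group: $\mathfrak S_{\vartriangle,r}$ is the group of all permutations $w:\mathbb Z\to\mathbb Z$ with $w(i+r)=w(i)+r$ for all $i$. The finite symmetric group $\mathfrak S_r$ is viewed as the subgroup of those $w$ that preserve $\{1,\dots,r\}$. For $1\le i\le r$ (with $r\ge2$) $s_i$ is defined by $s_i(j)=j$ if $j\not\equiv i,i+1 \bmod r$, $s_i(j)=j-1$ if $j\equiv i+1$, $s_i(j)=j+1$ if $j\equiv i \bmod r$; $W_r$ is the affine Weyl group generated by $\{s_1,\dots,s_r\}$ (trivial if $r=1$), and $\rho(j)=j+1$ for all $j$. Every element of $\mathfrak S_{\vartriangle,r}$ is $\rho^m w$ with $m\in\mathbb Z$, $w\in W_r$, and the length function is extended by $\ell(\rho^m w)=\ell(w)$. Hecke algebra: $H=\mathcal H_{\vartriangle}(r)_K$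 is the $K$-algebra, free as a $K$-module with basis $\{T_w\}_{w\in\mathfrak S_{\vartriangle,r}}$, with multiplication $T_sT_w=T_{sw}$ if $\ell(sw)=\ell(w)+1$, $T_sT_w=(\varepsilon^2-1)T_w+\varepsilon^2T_{sw}$ if $\ell(sw)<\ell(w)$ (for $s\in\{s_1,\dots,s_r\}$), and $T_\rho T_w=T_{\rho w}$. Compositions and tensor space: $\Lambda_{\vartriangle}(n,r)$ is the set of $n$-periodic sequences $(\lambda_i)_{i\in\mathbb Z}$ of nonnegative integers with $\lambda_1+\dots+\lambda_n=r$, identified with tuples $(\lambda_1,\dots,\lambda_n)$. $\mathfrak S_\lambda\subseteq\mathfrak S_r$ is the standard Young subgroup of $(\lambda_1,\dots,\lambda_n)$ and $x_\lambda=\sum_{w\in\mathfrak S_\lambda}T_w$. The right $H$-module $\bigoplus_\lambda x_\lambda H$ is isomorphic to the affine tensor space $\Omega_K^{\otimes r}$. It is a left module over $S$ by evaluation, and the right action of $H$ commutes with the action of $S$. (In the paper $S$ is defined as $\mathcal S_{\vartriangle}(n,r)_{\mathbb Z[v,v^{-1}]}\otimes K$ with $v\mapsto\varepsilon$, which is canonically identified with $\operatorname{End}_{H}\bigl(\bigoplus_{\lambda\in\Lambda_{\vartriangle}(n,r)}x_\lambda H\bigr)$.) *)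

theory Defs
  imports "HOL-Algebra.Algebra"
begin

section \<open>The extended affine symmetric group\<close>

definition ext_affine_sym :: "nat \<Rightarrow> (int \<Rightarrow> int) monoid" where
  "ext_affine_sym r =
     \<lparr>carrier = {w. bij w \<and> (\<forall>i. w (i + int r) = w i + int r)}, monoid.mult = (\<circ>), one = id\<rparr>"

definition fin_sym :: "nat \<Rightarrow> (int \<Rightarrow> int) set" where
  "fin_sym r = {w \<in> carrier (ext_affine_sym r). w ` {1..int r} = {1..int r}}"

definition simple_reflection :: "nat \<Rightarrow> int \<Rightarrow> int \<Rightarrow> int" where
  "simple_reflection r i j =
     (if j mod int r = (i + 1) mod int r then j - 1
      else if j mod int r = i mod int r then j + 1
      else j)"

definition simple_reflections :: "nat \<Rightarrow> (int \<Rightarrow> int) set" where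
  "simple_reflections r = (if 2 \<le> r then simple_reflection r ` {1..int r} else {})"

definition affine_weyl :: "nat \<Rightarrow> (int \<Rightarrow> int) set" where
  "affine_weyl r = generate (ext_affine_sym r) (simple_reflections r)"

definition shift :: "int \<Rightarrow> int" where
  "shift j = j + 1"

text \<open>Coxeter length on the affine Weyl group; not meaningful outside \<open>affine_weyl r\<close>.\<close>

definition affine_length :: "nat \<Rightarrow> (int \<Rightarrow> int) \<Rightarrow> nat" where
  "affine_length r w =
     (LEAST k. \<exists>ss. set ss \<subseteq> simple_reflections r \<and> length ss = k \<and> w = foldr (\<circ>) ss id)"

definition ext_length :: "nat \<Rightarrow> (int \<Rightarrow> int) \<Rightarrow> nat" where
  "ext_length r x =
     affine_length r (THE w. w \<in> affine_weyl r \<and>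
       (\<exists>m::int. x = (shift [^]\<^bsub>ext_affine_sym r\<^esub> m) \<otimes>\<^bsub>ext_affine_sym r\<^esub> w))"

lemma group_ext_affine_sym: "group (ext_affine_sym r)"
proof (rule groupI)
  fix x assume "x \<in> carrier (ext_affine_sym r)"
  then have b: "bij x" and p: "\<And>i. x (i + int r) = x i + int r"
    by (auto simp: ext_affine_sym_def)
  have "inv_into UNIV x (i + int r) = inv_into UNIV x i + int r" for i
    by (metis b bij_inv_eq_iff p)
  then have "inv_into UNIV x \<in> carrier (ext_affine_sym r)"
    using b by (auto simp: ext_affine_sym_def bij_imp_bij_inv)
  moreover have "inv_into UNIV x \<circ> x = id"
    using b by (simp add: bij_is_inj)
  ultimately show "\<exists>y\<in>carrier (ext_affine_sym r).
      y \<otimes>\<^bsub>ext_affine_sym r\<^esub> x = \<one>\<^bsub>ext_affine_sym r\<^esub>"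
    by (intro bexI[of _ "inv_into UNIV x"]) (auto simp: ext_affine_sym_def)
qed (auto simp: ext_affine_sym_def bij_comp comp_assoc)

lemma shift_closed: "shift \<in> carrier (ext_affine_sym r)"
proof -
  have "bij shift"
    by (rule bij_betw_byWitness[where f' = "\<lambda>j. j - 1"]) (auto simp: shift_def)
  then show ?thesis by (auto simp: ext_affine_sym_def shift_def)
qed

lemma simple_reflection_involutive:
  assumes "2 \<le> r"
  shows "simple_reflection r i (simple_reflection r i j) = j"
proof -
  let ?r = "int r"
  have eq: "a mod ?r = b mod ?r \<longleftrightarrow> ?r dvd a - b" for a b
    by (simp add: mod_eq_dvd_iff)
  have n1: "\<not> ?r dvd 1" using assms by simp
  have a: "?r dvd j - 1 - i \<longleftrightarrow> ?r dvd j - (i + 1)"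
    by (simp add: algebra_simps)
  have b: "?r dvd j + 1 - (i + 1) \<longleftrightarrow> ?r dvd j - i"
    by (simp add: algebra_simps)
  have c: "\<not> ?r dvd j - 1 - (i + 1)" if "?r dvd j - (i + 1)"
    using dvd_diff[OF that, of "j - 1 - (i + 1)"] n1 by auto
  show ?thesis
    unfolding simple_reflection_def eq using a b c by (auto split: if_splits)
qed

lemma simple_reflections_closed: "simple_reflections r \<subseteq> carrier (ext_affine_sym r)"
proof (clarsimp simp: simple_reflections_def)
  fix i assume r: "2 \<le> r"
  have "bij (simple_reflection r i)"
    using simple_reflection_involutive[OF r, of i]
    by (intro bij_betw_byWitness[where f' = "simple_reflection r i"]) auto
  then show "simple_reflection r i \<in> carrier (ext_affine_sym r)"
    by (auto simp: ext_affine_sym_def simple_reflection_def)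
qed


section \<open>Associative algebras and the extended affine Hecke algebra\<close>

text \<open>The library locale \<open>algebra\<close> requires commutativity.\<close>

locale assoc_algebra = module R A + ring A for R (structure) and A (structure) +
  assumes smult_mult_left:
      "\<lbrakk>a \<in> carrier R; x \<in> carrier A; y \<in> carrier A\<rbrakk> \<Longrightarrow>
        (a \<odot>\<^bsub>A\<^esub> x) \<otimes>\<^bsub>A\<^esub> y = a \<odot>\<^bsub>A\<^esub> (x \<otimes>\<^bsub>A\<^esub> y)"
    and smult_mult_right:
      "\<lbrakk>a \<in> carrier R; x \<in> carrier A; y \<in> carrier A\<rbrakk> \<Longrightarrow>
        x \<otimes>\<^bsub>A\<^esub> (a \<odot>\<^bsub>A\<^esub> y) = a \<odot>\<^bsub>A\<^esub> (x \<otimes>\<^bsub>A\<^esub> y)"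

definition algebra_hom ::
  "('a, 'm) ring_scheme \<Rightarrow> ('a, 'b, 'n) module_scheme \<Rightarrow> ('a, 'c, 'l) module_scheme \<Rightarrow> ('b \<Rightarrow> 'c) set"
  where
  "algebra_hom R A B =
     {f \<in> ring_hom A B. \<forall>a\<in>carrier R. \<forall>x\<in>carrier A. f (a \<odot>\<^bsub>A\<^esub> x) = a \<odot>\<^bsub>B\<^esub> f x}"

definition opposite :: "('a, 'b, 'm) module_scheme \<Rightarrow> ('a, 'b, 'm) module_scheme" where
  "opposite A = A\<lparr>monoid.mult := \<lambda>x y. y \<otimes>\<^bsub>A\<^esub> x\<rparr>"

definition free_basis ::
  "('a, 'm) ring_scheme \<Rightarrow> ('a, 'b, 'n) module_scheme \<Rightarrow> 'i set \<Rightarrow> ('i \<Rightarrow> 'b) \<Rightarrow> bool" where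
  "free_basis R M I b \<longleftrightarrow>
     b \<in> I \<rightarrow> carrier M \<and>
     (\<forall>x\<in>carrier M. \<exists>!c. c \<in> I \<rightarrow>\<^sub>E carrier R \<and> finite {i \<in> I. c i \<noteq> \<zero>\<^bsub>R\<^esub>} \<and>
        x = (\<Oplus>\<^bsub>M\<^esub>i\<in>{i \<in> I. c i \<noteq> \<zero>\<^bsub>R\<^esub>}. c i \<odot>\<^bsub>M\<^esub> b i))"

text \<open>
  The conditions determine \<open>(H, T)\<close> up to unique isomorphism. In particular
  \<open>T id = \<one>\<close> follows: \<open>T shift\<close> permutes the basis by left multiplication, hence is a
  unit of \<open>H\<close>, and \<open>T shift \<otimes> T id = T shift\<close>.
\<close>

locale ext_affine_hecke = assoc_algebra K H
  for K (structure) and H (structure) and \<epsilon> and r :: nat and T +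
  assumes basis: "free_basis K H (carrier (ext_affine_sym r)) T"
    and T_mult_up:
      "\<lbrakk>s \<in> simple_reflections r; w \<in> carrier (ext_affine_sym r);
        ext_length r (s \<circ> w) = ext_length r w + 1\<rbrakk> \<Longrightarrow>
        T s \<otimes>\<^bsub>H\<^esub> T w = T (s \<circ> w)"
    and T_mult_down:
      "\<lbrakk>s \<in> simple_reflections r; w \<in> carrier (ext_affine_sym r);
        ext_length r (s \<circ> w) < ext_length r w\<rbrakk> \<Longrightarrow>
        T s \<otimes>\<^bsub>H\<^esub> T w =
          ((\<epsilon> [^]\<^bsub>K\<^esub> (2::nat)) \<ominus>\<^bsub>K\<^esub> \<one>\<^bsub>K\<^esub>) \<odot>\<^bsub>H\<^esub> T w
          \<oplus>\<^bsub>H\<^esub> (\<epsilon> [^]\<^bsub>K\<^esub> (2::nat)) \<odot>\<^bsub>H\<^esub> T (s \<circ> w)"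
    and T_mult_shift:
      "w \<in> carrier (ext_affine_sym r) \<Longrightarrow> T shift \<otimes>\<^bsub>H\<^esub> T w = T (shift \<circ> w)"


section \<open>Compositions and tensor space\<close>

definition compositions :: "nat \<Rightarrow> nat \<Rightarrow> (int \<Rightarrow> nat) set" where
  "compositions n r = {\<mu>. (\<forall>i. \<mu> (i + int n) = \<mu> i) \<and> (\<Sum>i\<in>{1..int n}. \<mu> i) = r}"

definition block :: "(int \<Rightarrow> nat) \<Rightarrow> int \<Rightarrow> int set" where
  "block \<mu> i = {int (\<Sum>j\<in>{1..<i}. \<mu> j) <.. int (\<Sum>j\<in>{1..i}. \<mu> j)}"

definition young_subgroup :: "nat \<Rightarrow> nat \<Rightarrow> (int \<Rightarrow> nat) \<Rightarrow> (int \<Rightarrow> int) set" where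
  "young_subgroup n r \<mu> = {w \<in> fin_sym r. \<forall>i\<in>{1..int n}. w ` block \<mu> i = block \<mu> i}"

definition x_elt ::
  "('a, 'h, 'm) module_scheme \<Rightarrow> ((int \<Rightarrow> int) \<Rightarrow> 'h) \<Rightarrow> nat \<Rightarrow> nat \<Rightarrow> (int \<Rightarrow> nat) \<Rightarrow> 'h" where
  "x_elt H T n r \<mu> = (\<Oplus>\<^bsub>H\<^esub>w\<in>young_subgroup n r \<mu>. T w)"

text \<open>
  The external direct sum of the right ideals \<open>x\<^sub>\<mu> H\<close>; the index set is finite, so it is
  the product. Distinct \<open>\<mu>\<close> may give the same ideal but still contribute distinct summands.
  Only the \<open>K\<close>-module structure is used: the record fields \<open>mult\<close> and \<open>one\<close> are
  left unspecified.
\<close>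

definition tensor_space ::
  "('a, 'h, 'm) module_scheme \<Rightarrow> ((int \<Rightarrow> int) \<Rightarrow> 'h) \<Rightarrow> nat \<Rightarrow> nat
    \<Rightarrow> ('a, (int \<Rightarrow> nat) \<Rightarrow> 'h) module" where
  "tensor_space H T n r =
     \<lparr>carrier = (\<Pi>\<^sub>E \<mu>\<in>compositions n r. {x_elt H T n r \<mu> \<otimes>\<^bsub>H\<^esub> h | h. h \<in> carrier H}),
      monoid.mult = undefined, one = undefined,
      ring.zero = (\<lambda>\<mu>\<in>compositions n r. \<zero>\<^bsub>H\<^esub>),
      add = (\<lambda>s t. \<lambda>\<mu>\<in>compositions n r. s \<mu> \<oplus>\<^bsub>H\<^esub> t \<mu>),
      smult = (\<lambda>a t. \<lambda>\<mu>\<in>compositions n r. a \<odot>\<^bsub>H\<^esub> t \<mu>)\<rparr>"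

definition right_action ::
  "('a, 'h, 'm) module_scheme \<Rightarrow> nat \<Rightarrow> nat \<Rightarrow> 'h \<Rightarrow> ((int \<Rightarrow> nat) \<Rightarrow> 'h) \<Rightarrow> (int \<Rightarrow> nat) \<Rightarrow> 'h" where
  "right_action H n r h t = (\<lambda>\<mu>\<in>compositions n r. t \<mu> \<otimes>\<^bsub>H\<^esub> h)"


section \<open>Endomorphism algebras and the affine quantum Schur algebra\<close>

text \<open>
  Endomorphisms of a module \<open>M\<close> over a (possibly noncommutative) algebra with underlying set
  \<open>A\<close> acting, from the left or from the right, through \<open>act\<close>: the additive maps that commute
  with the action.
\<close>

definition endo_algebra ::
  "('a, 'm, 'l) module_scheme \<Rightarrow> 'b set \<Rightarrow> ('b \<Rightarrow> 'm \<Rightarrow> 'm) \<Rightarrow> ('a, 'm \<Rightarrow> 'm) module" where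
  "endo_algebra M A act =
     \<lparr>carrier = {f \<in> hom (add_monoid M) (add_monoid M) \<inter> extensional (carrier M).
                  \<forall>a\<in>A. \<forall>t\<in>carrier M. f (act a t) = act a (f t)},
      monoid.mult = (\<lambda>f g. compose (carrier M) f g), one = (\<lambda>t\<in>carrier M. t),
      ring.zero = (\<lambda>t\<in>carrier M. \<zero>\<^bsub>M\<^esub>),
      add = (\<lambda>f g. \<lambda>t\<in>carrier M. f t \<oplus>\<^bsub>M\<^esub> g t),
      smult = (\<lambda>c f. \<lambda>t\<in>carrier M. c \<odot>\<^bsub>M\<^esub> f t)\<rparr>"

definition schur_algebra ::
  "('a, 'h, 'm) module_scheme \<Rightarrow> ((int \<Rightarrow> int) \<Rightarrow> 'h) \<Rightarrow> nat \<Rightarrow> nat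
    \<Rightarrow> ('a, ((int \<Rightarrow> nat) \<Rightarrow> 'h) \<Rightarrow> (int \<Rightarrow> nat) \<Rightarrow> 'h) module" where
  "schur_algebra H T n r = endo_algebra (tensor_space H T n r) (carrier H) (right_action H n r)"

definition End_schur ::
  "('a, 'h, 'm) module_scheme \<Rightarrow> ((int \<Rightarrow> int) \<Rightarrow> 'h) \<Rightarrow> nat \<Rightarrow> nat
    \<Rightarrow> ('a, ((int \<Rightarrow> nat) \<Rightarrow> 'h) \<Rightarrow> (int \<Rightarrow> nat) \<Rightarrow> 'h) module" where
  "End_schur H T n r =
     endo_algebra (tensor_space H T n r) (carrier (schur_algebra H T n r)) (\<lambda>f t. f t)"

definition xi ::
  "('a, 'h, 'm) module_scheme \<Rightarrow> ((int \<Rightarrow> int) \<Rightarrow> 'h) \<Rightarrow> nat \<Rightarrow> nat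
    \<Rightarrow> 'h \<Rightarrow> ((int \<Rightarrow> nat) \<Rightarrow> 'h) \<Rightarrow> (int \<Rightarrow> nat) \<Rightarrow> 'h" where
  "xi H T n r h = (\<lambda>t\<in>carrier (tensor_space H T n r). right_action H n r h t)"

end

theory Submission
  imports Defs
begin

text \<open>
  That \<open>xi\<close> is an algebra homomorphism is formal; the content is injectivity. The composition
  \<open>(r, 0, \<dots>, 0)\<close> contributes the summand \<open>x H\<close>, where \<open>x\<close> is the sum of all \<open>T u\<close> with
  \<open>u\<close> in the finite symmetric group \<open>W\<close>. So it is enough that the right ideal \<open>x H\<close> is a
  faithful right module (\<open>sym_ideal_faithful\<close>). Write \<open>q = \<epsilon>\<^sup>2\<close>.

  An element lies in the \<open>q\<close>-eigenspace of left multiplication by every \<open>T s\<close>, with \<open>s\<close> a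
  simple reflection of \<open>W\<close>, if and only if its coefficients are constant on the cosets \<open>W v\<close>
  (\<open>left_invariant_eigen\<close>, \<open>eigen_left_invariant\<close>). The first property is kept by
  right multiplication, so all elements of \<open>x H\<close> are combinations of coset sums
  \<open>X D\<close>, the sum of \<open>T v\<close> over a coset \<open>D\<close>. The product \<open>X D T s\<close> is supported
  on \<open>D\<close> and \<open>D s\<close>, hence is \<open>a X D + b X (D s)\<close>, and if \<open>D s\<close> differs from \<open>D\<close>
  then \<open>b\<close> is \<open>1\<close> or \<open>q\<close>, a unit. Right multiplication by a translation permutes the
  coset sums. It follows that \<open>x H\<close> contains every coset sum (\<open>coset_sum_exists\<close>).

  Let \<open>h\<close> be a nonzero element of the Hecke algebra and \<open>z\<close> an element of maximal length in its
  support. There is an affine permutation \<open>y\<close> moving different residue classes by very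
  different amounts, so that the cosets \<open>W y w\<close> are pairwise different for all \<open>w\<close> of bounded
  displacement (\<open>spread_separates\<close>). For such \<open>y\<close>, multiplying \<open>X (W y)\<close> by
  \<open>T w\<close> one reflection at a time gives a unit multiple of \<open>X (W y w)\<close> plus multiples of coset sums
  \<open>X (W y w')\<close> with \<open>w'\<close> shorter than \<open>w\<close> (\<open>leading_term_reduced\<close>). Therefore the
  coefficient of \<open>X (W y) h\<close> at \<open>y z\<close> is a unit times the coefficient of \<open>h\<close> at \<open>z\<close>, and
  \<open>X (W y) h\<close> is not zero. Only units are divided by, so the argument applies to every
  commutative ring.

  The multiplication rules speak about the length, of which only a few properties are used.
  Sorting shows that every affine permutation is a translation times a word in the simple
  reflections (\<open>affine_perm_factor\<close>), the total displacement determines the translation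
  (\<open>translation_word_unique\<close>), and the sign of the permutation induced on residues determines
  the parity of the word (\<open>ext_length_parity\<close>). Hence multiplication by a simple
  reflection changes the length by exactly one, and one of the two rules always applies.
\<close>

section \<open>Words in the extended affine symmetric group\<close>

definition translation :: "int \<Rightarrow> int \<Rightarrow> int" where
  "translation m j = j + m"

definition word :: "(int \<Rightarrow> int) list \<Rightarrow> int \<Rightarrow> int" where
  "word ss = foldr (\<circ>) ss id"

lemma word_Nil [simp]: "word [] = id"
  by (simp add: word_def)

lemma word_Cons [simp]: "word (s # ss) = s \<circ> word ss"
  by (simp add: word_def)

abbreviation affine_perms :: "nat \<Rightarrow> (int \<Rightarrow> int) set" where
  "affine_perms r \<equiv> carrier (ext_affine_sym r)"

lemma affine_perms_iff:
  "w \<in> affine_perms r \<longleftrightarrow> bij w \<and> (\<forall>i. w (i + int r) = w i + int r)"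
  by (simp add: ext_affine_sym_def)

lemma affine_perms_periodic:
  assumes "w \<in> affine_perms r"
  shows "w (j + k * int r) = w j + k * int r"
proof (induction k rule: int_induct[where k = 0])
  case base
  then show ?case by simp
next
  case (step1 i)
  have "w (j + (i + 1) * int r) = w ((j + i * int r) + int r)"
    by (simp add: algebra_simps)
  then show ?case using assms step1 by (simp add: affine_perms_iff distrib_right)
next
  case (step2 i)
  have "w (j + i * int r) = w ((j + (i - 1) * int r) + int r)"
    by (simp add: algebra_simps)
  then have "w (j + i * int r) = w (j + (i - 1) * int r) + int r"
    using assms by (simp add: affine_perms_iff)
  then show ?case using step2 by (simp add: algebra_simps)
qed

lemma id_in_affine_perms: "id \<in> affine_perms r"
  by (simp add: affine_perms_iff)

lemma comp_in_affine_perms: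
  "\<lbrakk>v \<in> affine_perms r; w \<in> affine_perms r\<rbrakk> \<Longrightarrow> v \<circ> w \<in> affine_perms r"
  by (simp add: affine_perms_iff bij_comp)

lemma inv_in_affine_perms:
  assumes "w \<in> affine_perms r"
  shows "inv_into UNIV w \<in> affine_perms r"
proof -
  have "inv_into UNIV w (i + int r) = inv_into UNIV w i + int r" for i
    by (metis affine_perms_iff assms bij_inv_eq_iff)
  then show ?thesis using assms by (simp add: affine_perms_iff bij_imp_bij_inv)
qed

lemma translation_in_affine_perms: "translation m \<in> affine_perms r"
proof -
  have "bij (translation m)"
    by (rule bij_betw_byWitness[where f' = "translation (- m)"]) (auto simp: translation_def)
  then show ?thesis by (simp add: affine_perms_iff translation_def)
qed

lemma translation_comp: "translation a \<circ> translation b = translation (a + b)"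
  by (auto simp: translation_def fun_eq_iff)

lemma translation_0: "translation 0 = id"
  by (auto simp: translation_def fun_eq_iff)

lemma shift_eq_translation: "shift = translation 1"
  by (auto simp: translation_def shift_def fun_eq_iff)

lemma simple_in_affine_perms: "s \<in> simple_reflections r \<Longrightarrow> s \<in> affine_perms r"
  using simple_reflections_closed by blast

lemma word_append: "word (ss @ ts) = word ss \<circ> word ts"
  by (induction ss) (auto simp: comp_assoc)

lemma word_in_affine_perms: "set ss \<subseteq> simple_reflections r \<Longrightarrow> word ss \<in> affine_perms r"
proof (induction ss)
  case Nil
  then show ?case by (simp only: word_Nil id_in_affine_perms)
next
  case (Cons s ss)
  then show ?case
    using comp_in_affine_perms[OF simple_in_affine_perms, of s r "word ss"]
    by (metis insert_subset list.simps(15) word_Cons)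
qed

lemma simple_reflection_mod: "simple_reflection r (i mod int r) = simple_reflection r i"
  by (auto simp: simple_reflection_def fun_eq_iff mod_add_left_eq)

lemma simple_reflection_in_simple_reflections:
  assumes "2 \<le> r"
  shows "simple_reflection r i \<in> simple_reflections r"
proof -
  define k where "k = (i - 1) mod int r + 1"
  have "k \<in> {1..int r}" using assms by (auto simp: k_def intro: add1_zle_eq[THEN iffD2])
  moreover have "k mod int r = i mod int r" by (simp add: k_def mod_add_left_eq)
  then have "simple_reflection r i = simple_reflection r k"
    by (metis simple_reflection_mod)
  ultimately show ?thesis using assms by (simp add: simple_reflections_def)
qed

lemma simple_reflectionsE:
  assumes "s \<in> simple_reflections r"
  obtains i where "2 \<le> r" "s = simple_reflection r i"
  using assms by (auto simp: simple_reflections_def split: if_splits)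

lemma simple_comp_self: "s \<in> simple_reflections r \<Longrightarrow> s \<circ> s = id"
  by (elim simple_reflectionsE) (auto simp: fun_eq_iff simple_reflection_involutive)

lemma simple_cancel_left: "s \<in> simple_reflections r \<Longrightarrow> s \<circ> (s \<circ> w) = w"
  by (simp add: comp_assoc[symmetric] simple_comp_self)

lemma simple_cancel_right: "s \<in> simple_reflections r \<Longrightarrow> (w \<circ> s) \<circ> s = w"
  by (simp add: comp_assoc simple_comp_self)

lemma translation_conj_simple:
  assumes "s \<in> simple_reflections r"
  shows "translation m \<circ> s \<circ> translation (- m) \<in> simple_reflections r"
proof -
  obtain i where r: "2 \<le> r" and s: "s = simple_reflection r i"
    using assms by (rule simple_reflectionsE)
  have eq: "a mod int r = b mod int r \<longleftrightarrow> int r dvd a - b" for a b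
    by (simp add: mod_eq_dvd_iff)
  have "translation m \<circ> s \<circ> translation (- m) = simple_reflection r (i + m)"
    unfolding s simple_reflection_def eq translation_def
    by (auto simp: fun_eq_iff algebra_simps)
  then show ?thesis using simple_reflection_in_simple_reflections[OF r] by simp
qed

text \<open>
  Conjugation by a translation rotates the simple reflections, so a translation can be moved
  past a word without changing the number of its letters.
\<close>

lemma simple_comp_translation:
  assumes "s \<in> simple_reflections r"
  obtains s' where "s' \<in> simple_reflections r" "s \<circ> translation m = translation m \<circ> s'"
proof
  show "translation (- m) \<circ> s \<circ> translation m \<in> simple_reflections r"
    using translation_conj_simple[OF assms, of "- m"] by simp
  show "s \<circ> translation m = translation m \<circ> (translation (- m) \<circ> s \<circ> translation m)"
    by (auto simp: translation_def fun_eq_iff)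
qed

lemma word_comp_translation:
  assumes "set ss \<subseteq> simple_reflections r"
  obtains ss' where "set ss' \<subseteq> simple_reflections r" "length ss' = length ss"
    "word ss \<circ> translation m = translation m \<circ> word ss'"
  using assms
proof (induction ss arbitrary: thesis)
  case Nil
  then show ?case by (metis comp_id id_comp word_Nil)
next
  case (Cons s ss)
  have "set ss \<subseteq> simple_reflections r" using Cons.prems(2) by simp
  then obtain ss' where ss': "set ss' \<subseteq> simple_reflections r" "length ss' = length ss"
    "word ss \<circ> translation m = translation m \<circ> word ss'"
    using Cons.IH by blast
  obtain s' where s': "s' \<in> simple_reflections r" "s \<circ> translation m = translation m \<circ> s'"
    using Cons.prems(2) by (auto intro: simple_comp_translation)
  have "word (s # ss) \<circ> translation m = (s \<circ> translation m) \<circ> word ss'"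
    using ss'(3) by (simp add: comp_assoc)
  also have "\<dots> = translation m \<circ> word (s' # ss')"
    by (simp only: s'(2)) (simp add: comp_assoc)
  finally show ?case
    by (rule Cons.prems(1)[rotated 2]) (use ss' s' in auto)
qed

lemma word_displacement:
  "set ss \<subseteq> simple_reflections r \<Longrightarrow> \<bar>word ss j - j\<bar> \<le> int (length ss)"
proof (induction ss)
  case (Cons s ss)
  have "\<bar>s k - k\<bar> \<le> 1" for k
    using Cons.prems by (auto simp: simple_reflection_def elim!: simple_reflectionsE)
  from this[of "word ss j"] Cons show ?case by auto
qed simp

section \<open>Generation by translations and simple reflections\<close>

lemma sum_periodic_window:
  fixes f :: "int \<Rightarrow> int"
  assumes "\<And>j. f (j + int r) = f j" and "1 \<le> r"
  shows "sum f {k..<k + int r} = sum f {l..<l + int r}"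
proof -
  have step: "sum f {k..<k + int r} = sum f {k + 1..<k + 1 + int r}" for k
  proof -
    have "{k..<k + int r} = insert k {k + 1..<k + int r}"
      and "{k + 1..<k + 1 + int r} = insert (k + int r) {k + 1..<k + int r}"
      using assms(2) by auto
    then show ?thesis using assms(1)[of k] by simp
  qed
  have "sum f {k..<k + int r} = sum f {0..<0 + int r}" for k
  proof (induction k rule: int_induct[where k = 0])
    case (step1 i)
    then show ?case using step[of i] by simp
  next
    case (step2 i)
    then show ?case using step[of "i - 1"] by simp
  qed simp
  then show ?thesis by metis
qed

text \<open>
  The summands are periodic, so the window \<open>{1..r}\<close> may be replaced by
  \<open>{i..<i + r}\<close>. There the reflection just exchanges the values at the first two places.
  This covers the reflection \<open>i = r\<close>, which does not preserve \<open>{1..r}\<close>.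
\<close>

lemma sum_simple_reflection:
  fixes f :: "int \<Rightarrow> int \<Rightarrow> int"
  assumes r: "2 \<le> r" and w: "w \<in> affine_perms r"
    and f: "\<And>a j. f (a + int r) (j + int r) = f a j"
  shows "(\<Sum>j\<in>{1..int r}. f (w (simple_reflection r i j)) j) - (\<Sum>j\<in>{1..int r}. f (w j) j) =
     f (w (i + 1)) i + f (w i) (i + 1) - f (w i) i - f (w (i + 1)) (i + 1)"
proof -
  let ?s = "simple_reflection r i"
  have W: "{1..int r} = {1..<1 + int r}" by auto
  have s: "?s \<in> affine_perms r"
    using r by (intro simple_in_affine_perms simple_reflection_in_simple_reflections)
  have ws: "w \<circ> ?s \<in> affine_perms r" using w s by (rule comp_in_affine_perms)
  have shift_window: "(\<Sum>j\<in>{1..int r}. f (v j) j) = (\<Sum>j\<in>{i..<i + int r}. f (v j) j)"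
    if "v \<in> affine_perms r" for v
    unfolding W using that f r by (intro sum_periodic_window) (auto simp: affine_perms_iff)
  have split: "sum g {i..<i + int r} = g i + g (i + 1) + sum g {i + 2..<i + int r}"
    for g :: "int \<Rightarrow> int"
  proof -
    have "{i..<i + int r} = insert i (insert (i + 1) {i + 2..<i + int r})" using r by auto
    then show ?thesis by simp
  qed
  have eq: "a mod int r = b mod int r \<longleftrightarrow> int r dvd a - b" for a b
    by (simp add: mod_eq_dvd_iff)
  have n1: "\<not> int r dvd 1" "\<not> int r dvd - 1" using r by auto
  have "?s i = i + 1" "?s (i + 1) = i" using n1 by (auto simp: simple_reflection_def eq)
  moreover have "?s j = j" if "j \<in> {i + 2..<i + int r}" for j
  proof -
    have "\<not> int r dvd j - i" "\<not> int r dvd j - (i + 1)"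
      using that zdvd_not_zless[of "j - i" "int r"] zdvd_not_zless[of "j - (i + 1)" "int r"] by auto
    then show ?thesis by (simp add: simple_reflection_def eq)
  qed
  ultimately show ?thesis
    using shift_window[OF w] shift_window[OF ws] by (simp add: split)
qed

definition total_displacement :: "nat \<Rightarrow> (int \<Rightarrow> int) \<Rightarrow> int" where
  "total_displacement r w = (\<Sum>j\<in>{1..int r}. w j - j)"

definition square_displacement :: "nat \<Rightarrow> (int \<Rightarrow> int) \<Rightarrow> int" where
  "square_displacement r w = (\<Sum>j\<in>{1..int r}. (w j - j)\<^sup>2)"

text \<open>
  By \<open>sum_simple_reflection\<close> the difference is \<open>2 (w (i + 1) - w i)\<close>: the square
  displacement is a measure for the termination of sorting.
\<close>

lemma square_displacement_descent:
  assumes "2 \<le> r" "w \<in> affine_perms r" "w i > w (i + 1)"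
  shows "square_displacement r (w \<circ> simple_reflection r i) < square_displacement r w"
  using sum_simple_reflection[OF assms(1,2), of "\<lambda>a j. (a - j)\<^sup>2" i] assms(3)
  by (simp add: square_displacement_def power2_eq_square algebra_simps)

lemma total_displacement_comp_simple:
  assumes "w \<in> affine_perms r" "s \<in> simple_reflections r"
  shows "total_displacement r (w \<circ> s) = total_displacement r w"
proof -
  obtain i where "2 \<le> r" "s = simple_reflection r i" using assms(2) by (rule simple_reflectionsE)
  then show ?thesis using sum_simple_reflection[OF _ assms(1), of "\<lambda>a j. a - j" i]
    by (simp add: total_displacement_def)
qed

lemma total_displacement_word:
  assumes "set ss \<subseteq> simple_reflections r"
  shows "total_displacement r (translation m \<circ> word ss) = int r * m"
  using assms
proof (induction ss rule: rev_induct)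
  case Nil
  then show ?case by (simp add: total_displacement_def translation_def)
next
  case (snoc s ss)
  have "translation m \<circ> word (ss @ [s]) = (translation m \<circ> word ss) \<circ> s"
    by (simp add: word_append comp_assoc)
  moreover have "translation m \<circ> word ss \<in> affine_perms r"
    using snoc.prems by (auto intro!: comp_in_affine_perms translation_in_affine_perms word_in_affine_perms)
  ultimately show ?case
    using snoc total_displacement_comp_simple[of "translation m \<circ> word ss" r s]
    by (metis Un_iff list.set_intros(1) set_append subset_eq)
qed

text \<open>
  Simple reflections preserve the total displacement, whereas translation by \<open>m\<close> adds
  \<open>r m\<close> to it.
\<close>

lemma translation_word_unique:
  assumes "1 \<le> r" "set ss \<subseteq> simple_reflections r" "set ts \<subseteq> simple_reflections r"
    and "translation m \<circ> word ss = translation k \<circ> word ts"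
  shows "m = k" "word ss = word ts"
proof -
  show m: "m = k"
    using assms total_displacement_word[OF assms(2), of m] total_displacement_word[OF assms(3), of k]
    by simp
  have "translation (- m) \<circ> (translation m \<circ> word ss) = translation (- m) \<circ> (translation m \<circ> word ts)"
    using assms(4) m by simp
  then show "word ss = word ts"
    by (simp add: comp_assoc[symmetric] translation_comp translation_0)
qed

text \<open>
  Without a descent \<open>w\<close> is strictly increasing, and surjectivity leaves no room for gaps.
  For \<open>r = 1\<close> periodicity excludes descents.
\<close>

lemma affine_perm_descent:
  assumes r: "1 \<le> r" and w: "w \<in> affine_perms r" and nt: "\<And>m. w \<noteq> translation m"
  obtains i where "2 \<le> r" "w i > w (i + 1)"
proof -
  have b: "bij w" using w by (simp add: affine_perms_iff)
  have "\<exists>i. w i > w (i + 1)"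
  proof (rule ccontr)
    assume "\<not> ?thesis"
    then have le: "w i \<le> w (i + 1)" for i by (meson linorder_not_less)
    have lt: "w i < w (i + 1)" for i
      using le[of i] b by (metis bij_def inj_eq order_less_le add_cancel_right_right zero_neq_one)
    have mono: "i \<le> j \<Longrightarrow> w i \<le> w j" for i j
    proof (induction j rule: int_ge_induct)
      case (step k)
      then show ?case using lt[of k] by linarith
    qed simp
    have succ: "w (i + 1) = w i + 1" for i
    proof (rule ccontr)
      assume "w (i + 1) \<noteq> w i + 1"
      then have gap: "w i + 1 < w (i + 1)" using lt[of i] by simp
      obtain k where k: "w k = w i + 1" using b by (metis bij_pointE)
      show False
      proof (cases "k \<le> i")
        case True
        then show False using mono[of k i] k by simp
      next
        case False
        then show False using mono[of "i + 1" k] k gap by simp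
      qed
    qed
    have "w j = w 0 + j" for j
    proof (induction j rule: int_induct[where k = 0])
      case (step1 i)
      then show ?case using succ[of i] by simp
    next
      case (step2 i)
      then show ?case using succ[of "i - 1"] by simp
    qed simp
    then have "w = translation (w 0)" unfolding fun_eq_iff translation_def by (metis add.commute)
    then show False using nt by blast
  qed
  then obtain i where i: "w i > w (i + 1)" by blast
  have "r \<noteq> 1"
  proof
    assume "r = 1"
    then have "w (i + 1) = w i + 1" using w by (simp add: affine_perms_iff)
    then show False using i by simp
  qed
  then show thesis using that i r by simp
qed

lemma square_displacement_nonneg: "0 \<le> square_displacement r w"
  by (simp add: square_displacement_def sum_nonneg)

text \<open>
  Sorting \<open>w\<close> from the right: as long as \<open>w\<close> is not a translation it has a descent, and
  composing with the corresponding reflection lowers the square displacement.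
\<close>

lemma affine_perm_factor:
  assumes r: "1 \<le> r" and "w \<in> affine_perms r"
  obtains m ss where "set ss \<subseteq> simple_reflections r" "w = translation m \<circ> word ss"
  using assms(2)
proof (induction "nat (square_displacement r w)" arbitrary: w thesis rule: less_induct)
  case less
  show ?case
  proof (cases "\<exists>m. w = translation m")
    case True
    then show ?thesis using less.prems(1)[of "[]"] by auto
  next
    case False
    then obtain i where r2: "2 \<le> r" and i: "w i > w (i + 1)"
      using affine_perm_descent[OF r less.prems(2)] by blast
    define s where "s = simple_reflection r i"
    have s: "s \<in> simple_reflections r"
      using r2 by (simp add: s_def simple_reflection_in_simple_reflections)
    have "nat (square_displacement r (w \<circ> s)) < nat (square_displacement r w)"
      using square_displacement_descent[OF r2 less.prems(2) i] square_displacement_nonneg[of r "w \<circ> s"]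
      by (simp add: s_def)
    moreover have "w \<circ> s \<in> affine_perms r"
      using less.prems(2) simple_in_affine_perms[OF s] by (rule comp_in_affine_perms)
    ultimately obtain m ss where ss: "set ss \<subseteq> simple_reflections r" "w \<circ> s = translation m \<circ> word ss"
      using less.hyps[of "w \<circ> s"] by blast
    have "w = (w \<circ> s) \<circ> s" using s by (simp add: simple_cancel_right)
    also have "\<dots> = translation m \<circ> word (ss @ [s])"
      by (simp only: ss(2)) (simp add: word_append comp_assoc)
    finally show ?thesis using less.prems(1)[of "ss @ [s]" m] ss s by simp
  qed
qed

lemma fin_sym_subset: "u \<in> fin_sym r \<Longrightarrow> u \<in> affine_perms r"
  by (simp add: fin_sym_def)

lemma fin_sym_range: "\<lbrakk>u \<in> fin_sym r; j \<in> {1..int r}\<rbrakk> \<Longrightarrow> u j \<in> {1..int r}"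
  by (auto simp: fin_sym_def)

lemma simple_reflection_in_fin_sym:
  assumes "2 \<le> r" "1 \<le> i" "i < int r"
  shows "simple_reflection r i \<in> fin_sym r"
proof -
  let ?s = "simple_reflection r i"
  have "?s j \<in> {1..int r}" if j: "j \<in> {1..int r}" for j
  proof -
    have "j mod int r = (i + 1) mod int r \<Longrightarrow> j = i + 1"
      using j assms mod_eq_dvd_iff[of j "int r" "i + 1"]
      zdvd_not_zless[of "j - (i + 1)" "int r"] zdvd_not_zless[of "i + 1 - j" "int r"]
      dvd_diff_commute[of "int r" j "i + 1"] by force
    moreover have "j mod int r = i mod int r \<Longrightarrow> j = i"
      using j assms mod_eq_dvd_iff[of j "int r" i]
      zdvd_not_zless[of "j - i" "int r"] zdvd_not_zless[of "i - j" "int r"]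
      dvd_diff_commute[of "int r" j i] by force
    ultimately show ?thesis using j assms by (auto simp: simple_reflection_def)
  qed
  then have sub: "?s ` {1..int r} \<subseteq> {1..int r}" by blast
  have "{1..int r} \<subseteq> ?s ` {1..int r}"
  proof
    fix j assume "j \<in> {1..int r}"
    then have "?s j \<in> {1..int r}" using sub by blast
    then show "j \<in> ?s ` {1..int r}"
      using simple_reflection_involutive[OF assms(1), of i j] by (metis imageI)
  qed
  then have "?s ` {1..int r} = {1..int r}" using sub by blast
  then show ?thesis
    using simple_in_affine_perms[OF simple_reflection_in_simple_reflections[OF assms(1)], of i]
    by (simp add: fin_sym_def)
qed

lemma fin_sym_comp:
  assumes "u \<in> fin_sym r" "v \<in> fin_sym r"
  shows "u \<circ> v \<in> fin_sym r"
proof -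
  have "(u \<circ> v) ` {1..int r} = u ` v ` {1..int r}" by (rule image_comp[symmetric])
  also have "\<dots> = {1..int r}" using assms by (simp add: fin_sym_def)
  finally show ?thesis using assms by (simp add: fin_sym_def comp_in_affine_perms)
qed

lemma fin_sym_id: "id \<in> fin_sym r"
  by (simp add: fin_sym_def id_in_affine_perms)

lemma fin_sym_inv:
  assumes "u \<in> fin_sym r"
  shows "inv_into UNIV u \<in> fin_sym r"
proof -
  have "bij u" and "u ` {1..int r} = {1..int r}"
    using assms by (auto simp: fin_sym_def affine_perms_iff)
  then have "inv_into UNIV u ` {1..int r} = {1..int r}"
    by (metis bij_def image_inv_f_f)
  then show ?thesis using assms by (simp add: fin_sym_def inv_in_affine_perms)
qed

text \<open>
  The same sorting procedure stays inside the finite symmetric group: a descent at a multiple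
  of \<open>r\<close> would mean \<open>u r > u 1 + r\<close>, but both \<open>u 1\<close> and \<open>u r\<close> lie in
  \<open>{1..r}\<close>. So the simple reflections with \<open>1 \<le> i < r\<close> suffice.
\<close>

lemma fin_sym_induct [consumes 2, case_names id comp]:
  assumes r: "1 \<le> r" and "u \<in> fin_sym r"
    and "P id"
    and "\<And>u i. \<lbrakk>u \<in> fin_sym r; P u; 2 \<le> r; 1 \<le> i; i < int r\<rbrakk> \<Longrightarrow> P (u \<circ> simple_reflection r i)"
  shows "P u"
  using assms(2)
proof (induction "nat (square_displacement r u)" arbitrary: u rule: less_induct)
  case less
  note u = less.prems
  show ?case
  proof (cases "\<exists>m. u = translation m")
    case True
    then obtain m where m: "u = translation m" by blast
    have "u 1 \<in> {1..int r}" "u (int r) \<in> {1..int r}"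
      using r by (auto intro!: fin_sym_range[OF u] simp del: atLeastAtMost_iff) simp_all
    then have "m = 0" by (simp add: m translation_def)
    then show ?thesis using m assms(3) by (simp add: translation_0)
  next
    case False
    then obtain k where r2: "2 \<le> r" and k: "u k > u (k + 1)"
      using affine_perm_descent[OF r fin_sym_subset[OF u]] by blast
    \<comment> \<open>By periodicity the descent may be moved to a position in the window \<open>{1..r}\<close>.\<close>
    define i where "i = (k - 1) mod int r + 1"
    have i_range: "1 \<le> i" "i \<le> int r" using r by (auto simp: i_def intro: add1_zle_eq[THEN iffD2])
    have "k = i + ((k - 1) div int r) * int r"
      unfolding i_def using div_mult_mod_eq[of "k - 1" "int r"] by linarith
    then have ui: "u i > u (i + 1)"
      using k affine_perms_periodic[OF fin_sym_subset[OF u], of i "(k - 1) div int r"]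
        affine_perms_periodic[OF fin_sym_subset[OF u], of "i + 1" "(k - 1) div int r"]
      by (simp add: algebra_simps)
    have "i \<noteq> int r"
    proof
      assume "i = int r"
      then have "u (int r) > u 1 + int r"
        using ui fin_sym_subset[OF u] by (metis add.commute affine_perms_iff)
      moreover have "u 1 \<in> {1..int r}" "u (int r) \<in> {1..int r}"
        using r by (auto intro!: fin_sym_range[OF u] simp del: atLeastAtMost_iff) simp_all
      ultimately show False by simp
    qed
    then have i_lt: "i < int r" using i_range by simp
    let ?s = "simple_reflection r i"
    have "nat (square_displacement r (u \<circ> ?s)) < nat (square_displacement r u)"
      using square_displacement_descent[OF r2 fin_sym_subset[OF u] ui]
        square_displacement_nonneg[of r "u \<circ> ?s"] by simp
    moreover have us: "u \<circ> ?s \<in> fin_sym r"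
      using u simple_reflection_in_fin_sym[OF r2 i_range(1) i_lt] by (rule fin_sym_comp)
    ultimately have "P (u \<circ> ?s)" using less.hyps by blast
    then have "P ((u \<circ> ?s) \<circ> ?s)" using assms(4)[OF us] r2 i_range i_lt by blast
    then show ?thesis
      using simple_cancel_right[OF simple_reflection_in_simple_reflections[OF r2], of u i] by simp
  qed
qed

lemma finite_fin_sym:
  assumes "1 \<le> r"
  shows "finite (fin_sym r)"
proof (rule finite_imageD)
  let ?f = "\<lambda>w. restrict w {1..int r}"
  have "?f ` fin_sym r \<subseteq> {1..int r} \<rightarrow>\<^sub>E {1..int r}"
    by (auto simp: fin_sym_def)
  then show "finite (?f ` fin_sym r)"
    by (rule finite_subset) (auto intro: finite_PiE)
  show "inj_on ?f (fin_sym r)"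
  proof (rule inj_onI)
    fix u v assume u: "u \<in> fin_sym r" and v: "v \<in> fin_sym r" and eq: "?f u = ?f v"
    show "u = v"
    proof
      fix k
      define i where "i = (k - 1) mod int r + 1"
      have "i \<in> {1..int r}" using assms by (auto simp: i_def intro: add1_zle_eq[THEN iffD2])
      then have "u i = v i" using eq by (metis restrict_apply')
      moreover have "k = i + ((k - 1) div int r) * int r"
        unfolding i_def using div_mult_mod_eq[of "k - 1" "int r"] by linarith
      ultimately show "u k = v k"
        using affine_perms_periodic[OF fin_sym_subset[OF u], of i "(k - 1) div int r"]
          affine_perms_periodic[OF fin_sym_subset[OF v], of i "(k - 1) div int r"] by simp
    qed
  qed
qed

section \<open>The length function\<close>

text \<open>
  The permutation of the residues modulo \<open>r\<close> induced by an affine permutation, extended by the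
  identity so that the sign of permutations applies to it. Simple reflections become
  transpositions, also when \<open>r = 2\<close> and both reflections induce the same one.
\<close>

definition residue_perm :: "nat \<Rightarrow> (int \<Rightarrow> int) \<Rightarrow> int \<Rightarrow> int" where
  "residue_perm r w j = (if j \<in> {0..<int r} then w j mod int r else j)"

lemma affine_perms_mod:
  assumes "w \<in> affine_perms r"
  shows "w (j mod int r) mod int r = w j mod int r"
proof -
  have "w j = w (j mod int r + (j div int r) * int r)" by (simp only: mod_div_mult_eq)
  also have "\<dots> = w (j mod int r) + (j div int r) * int r"
    by (rule affine_perms_periodic[OF assms])
  finally show ?thesis by simp
qed

lemma residue_perm_comp:
  assumes "v \<in> affine_perms r"
  shows "residue_perm r (v \<circ> w) = residue_perm r v \<circ> residue_perm r w"
  using affine_perms_mod[OF assms] by (auto simp: residue_perm_def fun_eq_iff)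

lemma residue_perm_id: "residue_perm r id = id"
  by (auto simp: residue_perm_def fun_eq_iff)

lemma residue_perm_permutation:
  assumes "1 \<le> r" "w \<in> affine_perms r"
  shows "permutation (residue_perm r w)"
proof -
  have "bij w" using assms(2) by (simp add: affine_perms_iff)
  then have "inv_into UNIV w \<circ> w = id" "w \<circ> inv_into UNIV w = id"
    by (auto simp: bij_is_inj bij_is_surj surj_f_inv_f fun_eq_iff)
  then have "residue_perm r (inv_into UNIV w) \<circ> residue_perm r w = id"
    "residue_perm r w \<circ> residue_perm r (inv_into UNIV w) = id"
    unfolding residue_perm_comp[OF assms(2), symmetric]
      residue_perm_comp[OF inv_in_affine_perms[OF assms(2)], symmetric]
    by (simp_all only: residue_perm_id)
  then have "bij (residue_perm r w)" by (rule o_bij)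
  then have "residue_perm r w permutes {0..<int r}"
    unfolding permutes_def bij_iff by (simp add: residue_perm_def)
  then show ?thesis by (metis permutes_imp_permutation finite_atLeastLessThan_int)
qed

lemma sign_residue_perm_simple:
  assumes "s \<in> simple_reflections r"
  shows "sign (residue_perm r s) = - 1"
proof -
  obtain i where r: "2 \<le> r" and s: "s = simple_reflection r i"
    using assms by (rule simple_reflectionsE)
  have eq: "a mod int r = b mod int r \<longleftrightarrow> int r dvd a - b" for a b
    by (simp add: mod_eq_dvd_iff)
  have n1: "\<not> int r dvd 1" "\<not> int r dvd - 1" using r by auto
  have ne: "i mod int r \<noteq> (i + 1) mod int r" using n1 by (auto simp: eq)
  have "residue_perm r s = transpose (i mod int r) ((i + 1) mod int r)"
  proof
    fix j
    show "residue_perm r s j = transpose (i mod int r) ((i + 1) mod int r) j"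
    proof (cases "j \<in> {0..<int r}")
      case True
      then have j: "j = j mod int r" by simp
      consider "j = (i + 1) mod int r" | "j = i mod int r" "j \<noteq> (i + 1) mod int r"
        | "j \<noteq> i mod int r" "j \<noteq> (i + 1) mod int r" by blast
      then show ?thesis
      proof cases
        case 1
        then have "s j = j - 1" using j by (simp add: s simple_reflection_def)
        moreover have "(j - 1) mod int r = i mod int r"
          unfolding 1 by (simp add: mod_diff_left_eq)
        ultimately show ?thesis using True 1 by (simp add: residue_perm_def)
      next
        case 2
        then have "s j = j + 1" using j by (simp add: s simple_reflection_def)
        moreover have "(j + 1) mod int r = (i + 1) mod int r"
          using 2(1) by (simp add: mod_add_left_eq)
        ultimately show ?thesis using True 2 by (simp add: residue_perm_def)
      next
        case 3
        then have "s j = j" using j by (simp add: s simple_reflection_def)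
        then show ?thesis using True 3 by (simp add: residue_perm_def transpose_def)
      qed
    next
      case False
      moreover have "i mod int r \<in> {0..<int r}" "(i + 1) mod int r \<in> {0..<int r}" using r by auto
      ultimately show ?thesis by (auto simp: residue_perm_def transpose_def)
    qed
  qed
  then show ?thesis using ne by (simp add: sign_swap_id)
qed

lemma sign_residue_perm_word:
  assumes "1 \<le> r" "set ss \<subseteq> simple_reflections r"
  shows "sign (residue_perm r (word ss)) = (- 1) ^ length ss"
  using assms(2)
proof (induction ss)
  case Nil
  then show ?case by (metis length_0_conv power_0 residue_perm_id sign_id word_Nil)
next
  case (Cons s ss)
  then have s: "s \<in> simple_reflections r" and ss: "set ss \<subseteq> simple_reflections r" by auto
  have "sign (residue_perm r (word (s # ss))) = sign (residue_perm r s) * sign (residue_perm r (word ss))"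
    unfolding word_Cons residue_perm_comp[OF simple_in_affine_perms[OF s]]
    using assms(1) s ss
    by (intro sign_compose residue_perm_permutation simple_in_affine_perms word_in_affine_perms)
  then show ?case
    using Cons.IH[OF ss] sign_residue_perm_simple[OF s] unfolding length_Cons power_Suc by metis
qed

lemma shift_int_pow: "shift [^]\<^bsub>ext_affine_sym r\<^esub> (m::int) = translation m"
proof -
  interpret group "ext_affine_sym r" by (rule group_ext_affine_sym)
  have nat: "shift [^]\<^bsub>ext_affine_sym r\<^esub> k = translation (int k)" for k :: nat
    by (induction k) (auto simp: ext_affine_sym_def shift_eq_translation translation_def fun_eq_iff)
  show ?thesis
  proof (cases m)
    case (nonneg k)
    then show ?thesis using nat by (simp add: int_pow_int)
  next
    case (neg k)
    have "inv\<^bsub>ext_affine_sym r\<^esub> (translation (int (Suc k))) = translation (- int (Suc k))"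
      by (rule inv_equality)
        (auto simp: translation_in_affine_perms, auto simp: ext_affine_sym_def translation_def fun_eq_iff)
    then show ?thesis using nat[of "Suc k"] neg int_pow_neg_int[OF shift_closed, of "Suc k"] by simp
  qed
qed

lemma affine_weyl_iff: "w \<in> affine_weyl r \<longleftrightarrow> (\<exists>ss. set ss \<subseteq> simple_reflections r \<and> w = word ss)"
proof
  interpret group "ext_affine_sym r" by (rule group_ext_affine_sym)
  have mult: "x \<otimes>\<^bsub>ext_affine_sym r\<^esub> y = x \<circ> y" for x y by (simp add: ext_affine_sym_def)
  have one: "\<one>\<^bsub>ext_affine_sym r\<^esub> = id" by (simp add: ext_affine_sym_def)
  {
    assume "w \<in> affine_weyl r"
    then have "w \<in> generate (ext_affine_sym r) (simple_reflections r)" by (simp add: affine_weyl_def)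
    then show "\<exists>ss. set ss \<subseteq> simple_reflections r \<and> w = word ss"
    proof induction
      case one
      show ?case by (rule exI[of _ "[]"]) (simp add: ext_affine_sym_def)
    next
      case (incl h)
      then show ?case by (intro exI[of _ "[h]"]) simp
    next
      case (inv h)
      have "inv\<^bsub>ext_affine_sym r\<^esub> h = h"
        using simple_comp_self[OF inv] simple_in_affine_perms[OF inv]
        by (intro inv_equality) (auto simp: mult \<open>\<one>\<^bsub>ext_affine_sym r\<^esub> = id\<close>)
      then show ?case using inv by (intro exI[of _ "[h]"]) simp
    next
      case (eng h1 h2)
      then obtain ss ts where "set ss \<subseteq> simple_reflections r" "h1 = word ss"
        "set ts \<subseteq> simple_reflections r" "h2 = word ts" by blast
      then show ?case by (intro exI[of _ "ss @ ts"]) (auto simp: mult word_append)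
    qed
  next
    assume "\<exists>ss. set ss \<subseteq> simple_reflections r \<and> w = word ss"
    then obtain ss where ss: "set ss \<subseteq> simple_reflections r" and w: "w = word ss" by blast
    from ss have "word ss \<in> generate (ext_affine_sym r) (simple_reflections r)"
    proof (induction ss)
      case Nil
      then show ?case using generate.one[of "ext_affine_sym r"] by (simp only: one word_Nil)
    next
      case (Cons s ss)
      then have "s \<otimes>\<^bsub>ext_affine_sym r\<^esub> word ss \<in> generate (ext_affine_sym r) (simple_reflections r)"
        by (intro generate.eng) (auto intro: generate.incl)
      then show ?case by (simp only: mult word_Cons)
    qed
    then show "w \<in> affine_weyl r" unfolding w affine_weyl_def .
  }
qed

text \<open>
  The description in the definition of \<open>ext_length\<close> is proper because the factorisation into
  a translation and an element of the affine Weyl group is unique.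
\<close>

lemma ext_length_eq:
  assumes "1 \<le> r" "set ss \<subseteq> simple_reflections r"
  shows "ext_length r (translation m \<circ> word ss) = affine_length r (word ss)"
proof -
  have mult: "x \<otimes>\<^bsub>ext_affine_sym r\<^esub> y = x \<circ> y" for x y by (simp add: ext_affine_sym_def)
  have "(THE w. w \<in> affine_weyl r \<and> (\<exists>k::int. translation m \<circ> word ss = translation k \<circ> w)) = word ss"
  proof (rule the_equality)
    show "word ss \<in> affine_weyl r \<and> (\<exists>k. translation m \<circ> word ss = translation k \<circ> word ss)"
      using assms(2) by (metis affine_weyl_iff)
  next
    fix w assume "w \<in> affine_weyl r \<and> (\<exists>k. translation m \<circ> word ss = translation k \<circ> w)"
    then obtain k ts where "set ts \<subseteq> simple_reflections r" "w = word ts"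
      "translation m \<circ> word ss = translation k \<circ> word ts"
      unfolding affine_weyl_iff by blast
    then show "w = word ss" using translation_word_unique(2)[OF assms, of ts m k] by simp
  qed
  then show ?thesis unfolding ext_length_def shift_int_pow mult by simp
qed

lemma affine_length_eq:
  "affine_length r w = (LEAST k. \<exists>ss. set ss \<subseteq> simple_reflections r \<and> length ss = k \<and> w = word ss)"
  by (simp add: affine_length_def word_def)

lemma ext_length_le:
  assumes "1 \<le> r" "set ss \<subseteq> simple_reflections r"
  shows "ext_length r (translation m \<circ> word ss) \<le> length ss"
  unfolding ext_length_eq[OF assms] affine_length_eq using assms(2) by (intro Least_le) blast

lemma reduced_factor:
  assumes r: "1 \<le> r" and "x \<in> affine_perms r"
  obtains m ss where "set ss \<subseteq> simple_reflections r" "x = translation m \<circ> word ss"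
    "length ss = ext_length r x"
proof -
  obtain m ts where ts: "set ts \<subseteq> simple_reflections r" and x: "x = translation m \<circ> word ts"
    by (rule affine_perm_factor[OF assms])
  have "\<exists>ss. set ss \<subseteq> simple_reflections r \<and> length ss = affine_length r (word ts) \<and> word ts = word ss"
    unfolding affine_length_eq by (rule LeastI_ex) (use ts in blast)
  then obtain ss where "set ss \<subseteq> simple_reflections r" "length ss = affine_length r (word ts)"
    "word ts = word ss" by blast
  then show thesis using that[of ss m] x ext_length_eq[OF r ts, of m] by (simp only: )
qed

text \<open>
  Every letter of a word contributes a factor \<open>- 1\<close> to the sign of the residue permutation, so
  all words for the same element have the same parity.
\<close>

lemma ext_length_parity:
  assumes r: "1 \<le> r" and ss: "set ss \<subseteq> simple_reflections r"
  shows "even (ext_length r (translation m \<circ> word ss) + length ss)"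
proof -
  have "translation m \<circ> word ss \<in> affine_perms r"
    using ss by (intro comp_in_affine_perms translation_in_affine_perms word_in_affine_perms)
  then obtain k ts where ts: "set ts \<subseteq> simple_reflections r"
    and eq: "translation m \<circ> word ss = translation k \<circ> word ts"
    and len: "length ts = ext_length r (translation m \<circ> word ss)"
    by (rule reduced_factor[OF r])
  have "word ss = word ts" by (rule translation_word_unique(2)[OF r ss ts eq])
  then have "(- 1 :: int) ^ length ss = (- 1) ^ length ts"
    using sign_residue_perm_word[OF r ss] sign_residue_perm_word[OF r ts] by simp
  then show ?thesis unfolding len[symmetric] by (simp add: minus_one_power_iff split: if_splits)
qed

lemma ext_length_simple_left_le:
  assumes r: "1 \<le> r" and x: "x \<in> affine_perms r" and s: "s \<in> simple_reflections r"
  shows "ext_length r (s \<circ> x) \<le> ext_length r x + 1" "odd (ext_length r (s \<circ> x) + ext_length r x)"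
proof -
  obtain m ss where ss: "set ss \<subseteq> simple_reflections r" "x = translation m \<circ> word ss"
    "length ss = ext_length r x"
    by (rule reduced_factor[OF r x])
  obtain s' where s': "s' \<in> simple_reflections r" "s \<circ> translation m = translation m \<circ> s'"
    using s by (rule simple_comp_translation)
  have "s \<circ> x = (s \<circ> translation m) \<circ> word ss" unfolding ss(2) by (rule comp_assoc[symmetric])
  also have "\<dots> = translation m \<circ> word (s' # ss)" unfolding s'(2) word_Cons by (rule comp_assoc)
  finally have eq: "s \<circ> x = translation m \<circ> word (s' # ss)" .
  have set: "set (s' # ss) \<subseteq> simple_reflections r" using s'(1) ss(1) by simp
  show "ext_length r (s \<circ> x) \<le> ext_length r x + 1"
    using ext_length_le[OF r set, of m] ss(3) unfolding eq by simp
  show "odd (ext_length r (s \<circ> x) + ext_length r x)"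
    using ext_length_parity[OF r set, of m] ss(3) unfolding eq by simp
qed

text \<open>
  The two lengths differ by at most one and have different parities.
\<close>

lemma ext_length_simple_left:
  assumes r: "1 \<le> r" and x: "x \<in> affine_perms r" and s: "s \<in> simple_reflections r"
  shows "ext_length r (s \<circ> x) = ext_length r x + 1 \<or> ext_length r x = ext_length r (s \<circ> x) + 1"
proof -
  have sx: "s \<circ> x \<in> affine_perms r" using simple_in_affine_perms[OF s] x by (rule comp_in_affine_perms)
  have "ext_length r x \<le> ext_length r (s \<circ> x) + 1"
    using ext_length_simple_left_le(1)[OF r sx s] unfolding simple_cancel_left[OF s] .
  moreover have "ext_length r (s \<circ> x) \<noteq> ext_length r x"
    using ext_length_simple_left_le(2)[OF assms] by (metis even_add)
  ultimately show ?thesis using ext_length_simple_left_le(1)[OF assms] by linarith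
qed

lemma ext_length_simple_right_le:
  assumes r: "1 \<le> r" and x: "x \<in> affine_perms r" and s: "s \<in> simple_reflections r"
  shows "ext_length r (x \<circ> s) \<le> ext_length r x + 1" "odd (ext_length r (x \<circ> s) + ext_length r x)"
proof -
  obtain m ss where ss: "set ss \<subseteq> simple_reflections r" "x = translation m \<circ> word ss"
    "length ss = ext_length r x"
    by (rule reduced_factor[OF r x])
  have eq: "x \<circ> s = translation m \<circ> word (ss @ [s])"
    unfolding ss(2) word_append word_Cons word_Nil by (simp only: comp_assoc comp_id)
  have set: "set (ss @ [s]) \<subseteq> simple_reflections r" using s ss(1) by simp
  show "ext_length r (x \<circ> s) \<le> ext_length r x + 1"
    using ext_length_le[OF r set, of m] ss(3) unfolding eq by simp
  show "odd (ext_length r (x \<circ> s) + ext_length r x)"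
    using ext_length_parity[OF r set, of m] ss(3) unfolding eq by simp
qed

lemma ext_length_simple_right:
  assumes r: "1 \<le> r" and x: "x \<in> affine_perms r" and s: "s \<in> simple_reflections r"
  shows "ext_length r (x \<circ> s) = ext_length r x + 1 \<or> ext_length r x = ext_length r (x \<circ> s) + 1"
proof -
  have xs: "x \<circ> s \<in> affine_perms r" using x simple_in_affine_perms[OF s] by (rule comp_in_affine_perms)
  have "ext_length r x \<le> ext_length r (x \<circ> s) + 1"
    using ext_length_simple_right_le(1)[OF r xs s] unfolding simple_cancel_right[OF s] .
  moreover have "ext_length r (x \<circ> s) \<noteq> ext_length r x"
    using ext_length_simple_right_le(2)[OF assms] by (metis even_add)
  ultimately show ?thesis using ext_length_simple_right_le(1)[OF assms] by linarith
qed

lemma ext_length_translation: "1 \<le> r \<Longrightarrow> ext_length r (translation m) = 0"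
  using ext_length_le[of r "[]" m] by simp

lemma ext_length_translation_left:
  assumes r: "1 \<le> r" and x: "x \<in> affine_perms r"
  shows "ext_length r (translation k \<circ> x) = ext_length r x"
proof -
  obtain m ss where ss: "set ss \<subseteq> simple_reflections r" "x = translation m \<circ> word ss"
    by (rule affine_perm_factor[OF assms])
  have "translation k \<circ> x = translation (k + m) \<circ> word ss"
    unfolding ss(2) by (simp only: comp_assoc[symmetric] translation_comp)
  then show ?thesis using ss ext_length_eq[OF r ss(1)] by metis
qed

lemma ext_length_translation_right_le:
  assumes r: "1 \<le> r" and x: "x \<in> affine_perms r"
  shows "ext_length r (x \<circ> translation k) \<le> ext_length r x"
proof -
  obtain m ss where ss: "set ss \<subseteq> simple_reflections r" "x = translation m \<circ> word ss"
    "length ss = ext_length r x"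
    by (rule reduced_factor[OF assms])
  obtain ts where ts: "set ts \<subseteq> simple_reflections r" "length ts = length ss"
    "word ss \<circ> translation k = translation k \<circ> word ts"
    using ss(1) by (rule word_comp_translation)
  have "x \<circ> translation k = translation (m + k) \<circ> word ts"
    unfolding ss(2) comp_assoc ts(3) by (simp only: comp_assoc[symmetric] translation_comp)
  then show ?thesis using ext_length_le[OF r ts(1), of "m + k"] ts(2) ss(3) by simp
qed

lemma ext_length_translation_right:
  assumes r: "1 \<le> r" and x: "x \<in> affine_perms r"
  shows "ext_length r (x \<circ> translation k) = ext_length r x"
proof (rule antisym)
  show "ext_length r (x \<circ> translation k) \<le> ext_length r x"
    by (rule ext_length_translation_right_le[OF assms])
  have "(x \<circ> translation k) \<circ> translation (- k) = x"
    by (simp only: comp_assoc translation_comp) (simp add: translation_0)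
  then show "ext_length r x \<le> ext_length r (x \<circ> translation k)"
    using ext_length_translation_right_le[OF r comp_in_affine_perms[OF x translation_in_affine_perms], of k "- k"]
    by simp
qed

lemma ext_length_simple: "\<lbrakk>1 \<le> r; s \<in> simple_reflections r\<rbrakk> \<Longrightarrow> ext_length r s = 1"
  using ext_length_simple_left[of r id s] ext_length_translation[of r 0] id_in_affine_perms[of r]
  by (simp add: translation_0)

lemma ext_length_comp_le:
  assumes r: "1 \<le> r" and v: "v \<in> affine_perms r" and w: "w \<in> affine_perms r"
  shows "ext_length r (v \<circ> w) \<le> ext_length r v + ext_length r w"
proof -
  obtain m ss where ss: "set ss \<subseteq> simple_reflections r" "v = translation m \<circ> word ss"
    "length ss = ext_length r v"
    by (rule reduced_factor[OF r v])
  have "ext_length r (word ts \<circ> w) \<le> length ts + ext_length r w"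
    if "set ts \<subseteq> simple_reflections r" for ts
    using that
  proof (induction ts)
    case (Cons s ts)
    then have ts: "word ts \<in> affine_perms r" and s: "s \<in> simple_reflections r"
      by (auto intro: word_in_affine_perms)
    have "ext_length r (word ts \<circ> w) \<le> length ts + ext_length r w"
      by (rule Cons.IH) (use Cons.prems in simp)
    then have "ext_length r (s \<circ> (word ts \<circ> w)) \<le> length (s # ts) + ext_length r w"
      using ext_length_simple_left_le(1)[OF r comp_in_affine_perms[OF ts w] s] by simp
    then show ?case unfolding word_Cons comp_assoc .
  qed simp
  note word_bound = this[OF ss(1)]
  have "ext_length r (v \<circ> w) = ext_length r (word ss \<circ> w)"
    unfolding ss(2) comp_assoc using word_in_affine_perms[OF ss(1)] w
    by (intro ext_length_translation_left[OF r] comp_in_affine_perms)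
  then show ?thesis using word_bound ss(3) by simp
qed

lemma affine_perm_length_induct [consumes 2, case_names translation simple]:
  assumes r: "1 \<le> r" and "v \<in> affine_perms r"
    and "\<And>m. P (translation m)"
    and "\<And>s v. \<lbrakk>s \<in> simple_reflections r; v \<in> affine_perms r;
          ext_length r (s \<circ> v) = ext_length r v + 1; P v\<rbrakk> \<Longrightarrow> P (s \<circ> v)"
  shows "P v"
  using assms(2)
proof (induction "ext_length r v" arbitrary: v)
  case 0
  obtain m ss where ss: "set ss \<subseteq> simple_reflections r" "v = translation m \<circ> word ss"
    "length ss = ext_length r v"
    by (rule reduced_factor[OF r 0(2)])
  have "ss = []" using ss(3) 0(1) by (metis length_0_conv)
  then have "v = translation m" using ss(2) by simp
  then show ?case using assms(3) by simp
next
  case (Suc k)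
  obtain m ss where ss: "set ss \<subseteq> simple_reflections r" "v = translation m \<circ> word ss"
    "length ss = ext_length r v"
    by (rule reduced_factor[OF r Suc(3)])
  then obtain s' ts where sts: "ss = s' # ts" using Suc(2) by (metis length_Suc_conv)
  define v' where "v' = translation m \<circ> word ts"
  have ts: "set ts \<subseteq> simple_reflections r" and s': "s' \<in> simple_reflections r"
    using ss(1) sts by auto
  define s where "s = translation m \<circ> s' \<circ> translation (- m)"
  have s: "s \<in> simple_reflections r" unfolding s_def using s' by (rule translation_conj_simple)
  have v: "v = s \<circ> v'"
    unfolding ss(2) sts s_def v'_def word_Cons by (auto simp: translation_def fun_eq_iff)
  have v': "v' \<in> affine_perms r"
    unfolding v'_def using ts by (intro comp_in_affine_perms translation_in_affine_perms word_in_affine_perms)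
  have "ext_length r v' \<le> k"
    using ext_length_le[OF r ts, of m] ss(3) sts Suc(2) unfolding v'_def
    by (metis Suc_inject length_Cons)
  then have len: "ext_length r v' = k" "ext_length r (s \<circ> v') = ext_length r v' + 1"
    using ext_length_simple_left[OF r v' s] Suc(2) unfolding v by auto
  show ?case unfolding v using assms(4)[OF s v' len(2)] Suc(1)[OF len(1)[symmetric] v'] by simp
qed

section \<open>Coefficients in the extended affine Hecke algebra\<close>

locale affine_hecke_unit = ext_affine_hecke K H \<epsilon> r T
  for K :: "('a, 'k) ring_scheme" (structure)
    and H :: "('a, 'h, 'l) module_scheme" (structure)
    and \<epsilon> and r :: nat and T +
  assumes r_pos: "1 \<le> r" and parameter_unit: "\<epsilon> \<in> Units K"
begin

abbreviation "q \<equiv> \<epsilon> [^] (2::nat)"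

definition coef :: "'h \<Rightarrow> (int \<Rightarrow> int) \<Rightarrow> 'a" where
  "coef h = (THE c. c \<in> affine_perms r \<rightarrow>\<^sub>E carrier K \<and> finite {w \<in> affine_perms r. c w \<noteq> \<zero>} \<and>
     h = (\<Oplus>\<^bsub>H\<^esub>w\<in>{w \<in> affine_perms r. c w \<noteq> \<zero>}. c w \<odot>\<^bsub>H\<^esub> T w))"

abbreviation support :: "'h \<Rightarrow> (int \<Rightarrow> int) set" where
  "support h \<equiv> {w \<in> affine_perms r. coef h w \<noteq> \<zero>}"

lemma T_closed: "w \<in> affine_perms r \<Longrightarrow> T w \<in> carrier H"
  using basis by (auto simp: free_basis_def)

lemma \<epsilon>_closed: "\<epsilon> \<in> carrier K"
  using parameter_unit by blast

lemma q_closed [simp]: "q \<in> carrier K"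
  using \<epsilon>_closed by simp

lemma q_unit: "q \<in> Units K"
  using parameter_unit by (rule R.Units_pow_closed)

lemma coef_unique:
  assumes "h \<in> carrier H"
  shows "\<exists>!c. c \<in> affine_perms r \<rightarrow>\<^sub>E carrier K \<and> finite {w \<in> affine_perms r. c w \<noteq> \<zero>} \<and>
     h = (\<Oplus>\<^bsub>H\<^esub>w\<in>{w \<in> affine_perms r. c w \<noteq> \<zero>}. c w \<odot>\<^bsub>H\<^esub> T w)"
  using basis assms unfolding free_basis_def by blast

lemma coef_props:
  assumes "h \<in> carrier H"
  shows "coef h \<in> affine_perms r \<rightarrow>\<^sub>E carrier K" "finite (support h)"
    "h = (\<Oplus>\<^bsub>H\<^esub>w\<in>support h. coef h w \<odot>\<^bsub>H\<^esub> T w)"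
  using theI'[OF coef_unique[OF assms]] unfolding coef_def[symmetric] by blast+

lemma coef_closed [simp]: "\<lbrakk>h \<in> carrier H; w \<in> affine_perms r\<rbrakk> \<Longrightarrow> coef h w \<in> carrier K"
  using coef_props(1) by blast

lemma coef_finsum:
  assumes A: "finite A" "A \<subseteq> affine_perms r" and a: "a \<in> A \<rightarrow> carrier K" and v: "v \<in> affine_perms r"
  shows "coef (\<Oplus>\<^bsub>H\<^esub>w\<in>A. a w \<odot>\<^bsub>H\<^esub> T w) v = (if v \<in> A then a v else \<zero>)"
proof -
  let ?h = "\<Oplus>\<^bsub>H\<^esub>w\<in>A. a w \<odot>\<^bsub>H\<^esub> T w"
  define c where "c = (\<lambda>w\<in>affine_perms r. if w \<in> A then a w else \<zero>)"
  have h: "?h \<in> carrier H" using A a by (intro finsum_closed) (auto intro: smult_closed T_closed)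
  have sub: "{w \<in> affine_perms r. c w \<noteq> \<zero>} \<subseteq> A" by (auto simp: c_def)
  have "?h = (\<Oplus>\<^bsub>H\<^esub>w\<in>{w \<in> affine_perms r. c w \<noteq> \<zero>}. c w \<odot>\<^bsub>H\<^esub> T w)"
    using sub A a
    by (intro add.finprod_mono_neutral_cong_right)
      (auto simp: c_def smult_closed T_closed subset_iff Pi_iff)
  moreover have "finite {w \<in> affine_perms r. c w \<noteq> \<zero>}" using sub A(1) by (rule finite_subset)
  moreover have "c \<in> affine_perms r \<rightarrow>\<^sub>E carrier K" using a by (auto simp: c_def)
  ultimately have "coef ?h = c" unfolding coef_def by (intro the1_equality[OF coef_unique[OF h]]) blast
  then show ?thesis using v by (simp add: c_def)
qed

lemma coef_expansion:
  assumes "h \<in> carrier H" "finite A" "A \<subseteq> affine_perms r" "support h \<subseteq> A"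
  shows "h = (\<Oplus>\<^bsub>H\<^esub>w\<in>A. coef h w \<odot>\<^bsub>H\<^esub> T w)"
proof -
  have "(\<Oplus>\<^bsub>H\<^esub>w\<in>support h. coef h w \<odot>\<^bsub>H\<^esub> T w) = (\<Oplus>\<^bsub>H\<^esub>w\<in>A. coef h w \<odot>\<^bsub>H\<^esub> T w)"
    using assms by (intro add.finprod_mono_neutral_cong_left) (auto simp: smult_closed T_closed subset_iff)
  then show ?thesis using coef_props(3)[OF assms(1)] by simp
qed

lemma coef_T:
  assumes "w \<in> affine_perms r" "v \<in> affine_perms r"
  shows "coef (T w) v = (if v = w then \<one> else \<zero>)"
  using coef_finsum[of "{w}" "\<lambda>_. \<one>" v] assms by (simp add: T_closed)

lemma coef_add:
  assumes "g \<in> carrier H" "h \<in> carrier H" "v \<in> affine_perms r"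
  shows "coef (g \<oplus>\<^bsub>H\<^esub> h) v = coef g v \<oplus> coef h v"
proof -
  define A where "A = insert v (support g \<union> support h)"
  have A: "finite A" "A \<subseteq> affine_perms r"
    using coef_props(2)[OF assms(1)] coef_props(2)[OF assms(2)] assms(3) by (auto simp: A_def)
  have "g \<oplus>\<^bsub>H\<^esub> h = (\<Oplus>\<^bsub>H\<^esub>w\<in>A. coef g w \<odot>\<^bsub>H\<^esub> T w) \<oplus>\<^bsub>H\<^esub> (\<Oplus>\<^bsub>H\<^esub>w\<in>A. coef h w \<odot>\<^bsub>H\<^esub> T w)"
    using coef_expansion[OF assms(1) A] coef_expansion[OF assms(2) A] by (simp add: A_def subset_iff)
  also have "\<dots> = (\<Oplus>\<^bsub>H\<^esub>w\<in>A. coef g w \<odot>\<^bsub>H\<^esub> T w \<oplus>\<^bsub>H\<^esub> coef h w \<odot>\<^bsub>H\<^esub> T w)"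
    using A assms by (intro finsum_addf[symmetric]) (auto simp: smult_closed T_closed subset_iff)
  also have "\<dots> = (\<Oplus>\<^bsub>H\<^esub>w\<in>A. (coef g w \<oplus> coef h w) \<odot>\<^bsub>H\<^esub> T w)"
    using A assms by (intro finsum_cong) (auto simp: smult_closed T_closed subset_iff smult_l_distr)
  finally show ?thesis
    using coef_finsum[OF A, of "\<lambda>w. coef g w \<oplus> coef h w" v] A assms
    by (auto simp: A_def subset_iff)
qed

lemma coef_smult:
  assumes "a \<in> carrier K" "h \<in> carrier H" "v \<in> affine_perms r"
  shows "coef (a \<odot>\<^bsub>H\<^esub> h) v = a \<otimes> coef h v"
proof -
  define A where "A = insert v (support h)"
  have A: "finite A" "A \<subseteq> affine_perms r"
    using coef_props(2)[OF assms(2)] assms(3) by (auto simp: A_def)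
  have "a \<odot>\<^bsub>H\<^esub> h = a \<odot>\<^bsub>H\<^esub> (\<Oplus>\<^bsub>H\<^esub>w\<in>A. coef h w \<odot>\<^bsub>H\<^esub> T w)"
    using coef_expansion[OF assms(2) A] by (simp add: A_def subset_iff)
  also have "\<dots> = (\<Oplus>\<^bsub>H\<^esub>w\<in>A. a \<odot>\<^bsub>H\<^esub> (coef h w \<odot>\<^bsub>H\<^esub> T w))"
    using A assms by (intro finsum_smult_ldistr) (auto simp: smult_closed T_closed subset_iff)
  also have "\<dots> = (\<Oplus>\<^bsub>H\<^esub>w\<in>A. (a \<otimes> coef h w) \<odot>\<^bsub>H\<^esub> T w)"
    using A assms by (intro finsum_cong) (auto simp: smult_closed T_closed subset_iff smult_assoc1)
  finally show ?thesis
    using coef_finsum[OF A, of "\<lambda>w. a \<otimes> coef h w" v] A assms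
    by (auto simp: A_def subset_iff)
qed

lemma coef_zero: "v \<in> affine_perms r \<Longrightarrow> coef \<zero>\<^bsub>H\<^esub> v = \<zero>"
  using coef_finsum[of "{}" "\<lambda>_. \<one>" v] by simp

lemma coef_eqI:
  assumes "g \<in> carrier H" "h \<in> carrier H" "\<And>v. v \<in> affine_perms r \<Longrightarrow> coef g v = coef h v"
  shows "g = h"
proof -
  have supp: "support g = support h" using assms(3) by auto
  have "(\<Oplus>\<^bsub>H\<^esub>w\<in>support h. coef g w \<odot>\<^bsub>H\<^esub> T w) = (\<Oplus>\<^bsub>H\<^esub>w\<in>support h. coef h w \<odot>\<^bsub>H\<^esub> T w)"
    using assms by (intro finsum_cong) (auto simp: smult_closed T_closed)
  then show ?thesis using coef_props(3)[OF assms(1)] coef_props(3)[OF assms(2)] supp by simp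
qed

lemma span_induct [consumes 1, case_names zero add]:
  assumes "h \<in> carrier H" and zero: "P \<zero>\<^bsub>H\<^esub>"
    and add: "\<And>a w h. \<lbrakk>a \<in> carrier K; w \<in> affine_perms r; h \<in> carrier H; P h\<rbrakk> \<Longrightarrow> P (a \<odot>\<^bsub>H\<^esub> T w \<oplus>\<^bsub>H\<^esub> h)"
  shows "P h"
proof -
  have "P (\<Oplus>\<^bsub>H\<^esub>w\<in>A. coef h w \<odot>\<^bsub>H\<^esub> T w)" if "finite A" "A \<subseteq> affine_perms r" for A
    using that
  proof induction
    case empty
    then show ?case using zero by simp
  next
    case (insert x A)
    then show ?case using assms(1)
      by (subst finsum_insert) (auto intro!: add finsum_closed simp: smult_closed T_closed subset_iff)
  qed
  from this[of "support h"] show ?thesis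
    using coef_props(2,3)[OF assms(1)] by auto
qed

text \<open>
  A formula expressing a coefficient of \<open>L h\<close> linearly through two coefficients of \<open>h\<close>
  needs to be checked for basis elements only.
\<close>

lemma coef_linear_map:
  assumes closed: "\<And>h. h \<in> carrier H \<Longrightarrow> L h \<in> carrier H"
    and add: "\<And>g h. \<lbrakk>g \<in> carrier H; h \<in> carrier H\<rbrakk> \<Longrightarrow> L (g \<oplus>\<^bsub>H\<^esub> h) = L g \<oplus>\<^bsub>H\<^esub> L h"
    and smult: "\<And>a h. \<lbrakk>a \<in> carrier K; h \<in> carrier H\<rbrakk> \<Longrightarrow> L (a \<odot>\<^bsub>H\<^esub> h) = a \<odot>\<^bsub>H\<^esub> L h"
    and uv: "u \<in> affine_perms r" "v \<in> affine_perms r" and ab: "\<alpha> \<in> carrier K" "\<beta> \<in> carrier K"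
    and basis_eq: "\<And>w. w \<in> affine_perms r \<Longrightarrow> coef (L (T w)) v = \<alpha> \<otimes> coef (T w) u \<oplus> \<beta> \<otimes> coef (T w) v"
    and h: "h \<in> carrier H"
  shows "coef (L h) v = \<alpha> \<otimes> coef h u \<oplus> \<beta> \<otimes> coef h v"
  using h
proof (induction rule: span_induct)
  case zero
  have "L \<zero>\<^bsub>H\<^esub> = L (\<zero> \<odot>\<^bsub>H\<^esub> \<zero>\<^bsub>H\<^esub>)" by simp
  also have "\<dots> = \<zero>\<^bsub>H\<^esub>" using smult[of \<zero> "\<zero>\<^bsub>H\<^esub>"] closed[of "\<zero>\<^bsub>H\<^esub>"] by simp
  finally show ?case using uv ab by (simp add: coef_zero)
next
  case (add a w h)
  have "coef (L (a \<odot>\<^bsub>H\<^esub> T w \<oplus>\<^bsub>H\<^esub> h)) v = a \<otimes> coef (L (T w)) v \<oplus> coef (L h) v"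
    using add.hyps uv by (simp add: assms(2) smult closed T_closed smult_closed coef_add coef_smult)
  also have "\<dots> = a \<otimes> (\<alpha> \<otimes> coef (T w) u \<oplus> \<beta> \<otimes> coef (T w) v) \<oplus> (\<alpha> \<otimes> coef h u \<oplus> \<beta> \<otimes> coef h v)"
    using add.IH basis_eq[OF add.hyps(2)] by simp
  also have "\<dots> = \<alpha> \<otimes> (a \<otimes> coef (T w) u \<oplus> coef h u) \<oplus> \<beta> \<otimes> (a \<otimes> coef (T w) v \<oplus> coef h v)"
    using add.hyps uv ab coef_closed[OF T_closed[OF add.hyps(2)] uv(1)]
      coef_closed[OF T_closed[OF add.hyps(2)] uv(2)] coef_closed[OF add.hyps(3) uv(1)]
      coef_closed[OF add.hyps(3) uv(2)]
    by (simp add: R.r_distr R.m_lcomm R.a_ac)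
  finally show ?case
    using add.hyps uv by (simp add: T_closed smult_closed coef_add coef_smult)
qed

section \<open>Multiplication of basis elements\<close>

lemma ext_length_less_iff:
  assumes "s \<in> simple_reflections r" "v \<in> affine_perms r"
  shows "\<not> ext_length r (s \<circ> v) < ext_length r v \<longleftrightarrow> ext_length r (s \<circ> v) = ext_length r v + 1"
  using ext_length_simple_left[OF r_pos assms(2,1)] by auto

lemma simple_comp_closed:
  "\<lbrakk>s \<in> simple_reflections r; v \<in> affine_perms r\<rbrakk> \<Longrightarrow> s \<circ> v \<in> affine_perms r"
  by (simp add: comp_in_affine_perms simple_in_affine_perms)

lemma comp_simple_closed:
  "\<lbrakk>s \<in> simple_reflections r; v \<in> affine_perms r\<rbrakk> \<Longrightarrow> v \<circ> s \<in> affine_perms r"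
  by (simp add: comp_in_affine_perms simple_in_affine_perms)

text \<open>
  The two multiplication rules, read off from the target: only \<open>T v\<close> and \<open>T (s \<circ> v)\<close>
  contribute to the coefficient at \<open>v\<close>, and left multiplication by \<open>s\<close> goes up from
  exactly one of \<open>v\<close> and \<open>s \<circ> v\<close>.
\<close>

lemma coef_T_simple_mult:
  assumes s: "s \<in> simple_reflections r" and h: "h \<in> carrier H" and v: "v \<in> affine_perms r"
  shows "coef (T s \<otimes>\<^bsub>H\<^esub> h) v =
    (if ext_length r (s \<circ> v) < ext_length r v then coef h (s \<circ> v) \<oplus> (q \<ominus> \<one>) \<otimes> coef h v
     else q \<otimes> coef h (s \<circ> v))"
proof -
  let ?down = "\<lambda>w. ext_length r (s \<circ> w) < ext_length r w"
  have Ts: "T s \<in> carrier H" using s by (intro T_closed simple_in_affine_perms)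
  have sv: "s \<circ> v \<in> affine_perms r" using s v by (rule simple_comp_closed)
  have basis_eq: "coef (T s \<otimes>\<^bsub>H\<^esub> T w) v =
      (if ?down v then \<one> else q) \<otimes> coef (T w) (s \<circ> v) \<oplus>
      (if ?down v then q \<ominus> \<one> else \<zero>) \<otimes> coef (T w) v" if w: "w \<in> affine_perms r" for w
  proof -
    have sw: "s \<circ> w \<in> affine_perms r" using s w by (rule simple_comp_closed)
    have iff: "s \<circ> v = w \<longleftrightarrow> v = s \<circ> w" using simple_cancel_left[OF s] by metis
    have ne: "s \<circ> w \<noteq> w" using ext_length_simple_left[OF r_pos w s] by auto
    show ?thesis
    proof (cases "?down w")
      case True
      have "coef (T s \<otimes>\<^bsub>H\<^esub> T w) v = (q \<ominus> \<one>) \<otimes> coef (T w) v \<oplus> q \<otimes> coef (T (s \<circ> w)) v"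
        unfolding T_mult_down[OF s w True] using v w sw
        by (simp add: coef_add coef_smult T_closed smult_closed)
      moreover have "\<not> ?down v" if "v = s \<circ> w"
        using True unfolding that simple_cancel_left[OF s] by simp
      ultimately show ?thesis using True ne w v sv sw unfolding coef_T[OF w v] coef_T[OF w sv] coef_T[OF sw v] iff
        by (auto simp: R.minus_closed)
    next
      case False
      then have up: "ext_length r (s \<circ> w) = ext_length r w + 1" using ext_length_less_iff[OF s w] by simp
      have "coef (T s \<otimes>\<^bsub>H\<^esub> T w) v = coef (T (s \<circ> w)) v"
        unfolding T_mult_up[OF s w up] ..
      moreover have "?down v" if "v = s \<circ> w"
        using up unfolding that simple_cancel_left[OF s] by simp
      ultimately show ?thesis using False ne w v sv sw unfolding coef_T[OF w v] coef_T[OF w sv] coef_T[OF sw v] iff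
        by (auto simp: R.minus_closed)
    qed
  qed
  have "coef (T s \<otimes>\<^bsub>H\<^esub> h) v =
      (if ?down v then \<one> else q) \<otimes> coef h (s \<circ> v) \<oplus> (if ?down v then q \<ominus> \<one> else \<zero>) \<otimes> coef h v"
    by (rule coef_linear_map[where L = "\<lambda>h. T s \<otimes>\<^bsub>H\<^esub> h"])
      (use Ts sv v h basis_eq in \<open>auto simp: r_distr smult_mult_right R.minus_closed\<close>)
  then show ?thesis using sv v h by (auto simp: R.minus_closed)
qed

lemma coef_T_shift_mult:
  assumes h: "h \<in> carrier H" and v: "v \<in> affine_perms r"
  shows "coef (T shift \<otimes>\<^bsub>H\<^esub> h) (shift \<circ> v) = coef h v"
proof -
  have sv: "shift \<circ> v \<in> affine_perms r" using shift_closed v by (rule comp_in_affine_perms)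
  have inj: "shift \<circ> v = shift \<circ> w \<longleftrightarrow> v = w" for w :: "int \<Rightarrow> int"
    by (auto simp: shift_def fun_eq_iff)
  have basis_eq: "coef (T shift \<otimes>\<^bsub>H\<^esub> T w) (shift \<circ> v) =
      \<one> \<otimes> coef (T w) v \<oplus> \<zero> \<otimes> coef (T w) (shift \<circ> v)" if w: "w \<in> affine_perms r" for w
    using w v sv inj comp_in_affine_perms[OF shift_closed w]
    by (simp add: T_mult_shift[OF w] coef_T)
  have "coef (T shift \<otimes>\<^bsub>H\<^esub> h) (shift \<circ> v) = \<one> \<otimes> coef h v \<oplus> \<zero> \<otimes> coef h (shift \<circ> v)"
    by (rule coef_linear_map[where L = "\<lambda>h. T shift \<otimes>\<^bsub>H\<^esub> h"])
      (use T_closed[OF shift_closed] sv v h basis_eq in \<open>auto simp: r_distr smult_mult_right\<close>)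
  then show ?thesis using sv v h by simp
qed

lemma T_shift_cancel:
  assumes "g \<in> carrier H" "h \<in> carrier H" "T shift \<otimes>\<^bsub>H\<^esub> g = T shift \<otimes>\<^bsub>H\<^esub> h"
  shows "g = h"
  using assms coef_T_shift_mult by (intro coef_eqI) metis+

lemma T_id: "T id = \<one>\<^bsub>H\<^esub>"
proof (rule T_shift_cancel)
  show "T shift \<otimes>\<^bsub>H\<^esub> T id = T shift \<otimes>\<^bsub>H\<^esub> \<one>\<^bsub>H\<^esub>"
    using T_mult_shift[OF id_in_affine_perms] T_closed[OF shift_closed] by simp
qed (auto intro: T_closed id_in_affine_perms)

text \<open>
  Upward induction from \<open>0\<close> uses the rule for \<open>T shift\<close> directly; for negative
  translations \<open>T shift\<close> is multiplied to both sides and cancelled.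
\<close>

lemma T_translation_mult:
  assumes w: "w \<in> affine_perms r"
  shows "T (translation m) \<otimes>\<^bsub>H\<^esub> T w = T (translation m \<circ> w)"
proof -
  have shift_translation: "shift \<circ> (translation k \<circ> v) = translation (k + 1) \<circ> v" for k and v :: "int \<Rightarrow> int"
    by (auto simp: shift_def translation_def fun_eq_iff)
  have T_step: "T (translation (k + 1) \<circ> v) = T shift \<otimes>\<^bsub>H\<^esub> T (translation k \<circ> v)"
    if "v \<in> affine_perms r" for k v
    using T_mult_shift[OF comp_in_affine_perms[OF translation_in_affine_perms that], of k]
    by (simp only: shift_translation)
  have T_step': "T (translation (k + 1)) = T shift \<otimes>\<^bsub>H\<^esub> T (translation k)" for k
    using T_step[OF id_in_affine_perms, of k] by simp
  note closed = T_closed[OF w] T_closed[OF shift_closed] T_closed[OF translation_in_affine_perms]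
    T_closed[OF comp_in_affine_perms[OF translation_in_affine_perms w]]
  show ?thesis
  proof (induction m rule: int_induct[where k = 0])
    case base
    show ?case using closed(1) by (simp only: translation_0 T_id id_comp l_one)
  next
    case (step1 i)
    have "T (translation (i + 1)) \<otimes>\<^bsub>H\<^esub> T w = T shift \<otimes>\<^bsub>H\<^esub> (T (translation i) \<otimes>\<^bsub>H\<^esub> T w)"
      unfolding T_step' using closed by (intro m_assoc)
    also have "\<dots> = T (translation (i + 1) \<circ> w)"
      using step1(2) T_step[OF w, of i] by metis
    finally show ?case .
  next
    case (step2 i)
    have "T shift \<otimes>\<^bsub>H\<^esub> (T (translation (i - 1)) \<otimes>\<^bsub>H\<^esub> T w) = T (translation i) \<otimes>\<^bsub>H\<^esub> T w"
      using closed T_step'[of "i - 1"] by (simp add: m_assoc)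
    also have "\<dots> = T shift \<otimes>\<^bsub>H\<^esub> T (translation (i - 1) \<circ> w)"
      using step2(2) T_step[OF w, of "i - 1"] by (metis diff_add_cancel)
    finally show ?case by (rule T_shift_cancel[rotated 2]) (use closed in auto)
  qed
qed

text \<open>
  The defining rules only describe left multiplication by generators. Here they are
  extended to a factor \<open>v\<close> of any length by removing simple reflections from the left of
  \<open>v\<close>: if lengths add up for \<open>v\<close> they still do for the shortened factor. The rules
  for right multiplication by a simple reflection or a translation are special cases.
\<close>

lemma T_mult_reduced:
  assumes v: "v \<in> affine_perms r" and w: "w \<in> affine_perms r"
    and len: "ext_length r (v \<circ> w) = ext_length r v + ext_length r w"
  shows "T v \<otimes>\<^bsub>H\<^esub> T w = T (v \<circ> w)"
  using r_pos v len
proof (induction v rule: affine_perm_length_induct)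
  case (translation m)
  show ?case using w by (rule T_translation_mult)
next
  case (simple s v)
  note s = simple.hyps(1) and v = simple.hyps(2) and up = simple.hyps(3)
  have vw: "v \<circ> w \<in> affine_perms r" using v w by (rule comp_in_affine_perms)
  have total: "ext_length r (s \<circ> (v \<circ> w)) = ext_length r v + 1 + ext_length r w"
    using simple.prems up by (simp only: comp_assoc)
  then have len: "ext_length r (v \<circ> w) = ext_length r v + ext_length r w"
    using ext_length_simple_left_le(1)[OF r_pos vw s] ext_length_comp_le[OF r_pos v w] by linarith
  have "T (s \<circ> v) \<otimes>\<^bsub>H\<^esub> T w = T s \<otimes>\<^bsub>H\<^esub> (T v \<otimes>\<^bsub>H\<^esub> T w)"
    unfolding T_mult_up[OF s v up, symmetric] using s v w
    by (intro m_assoc T_closed) (simp_all add: simple_in_affine_perms)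
  also have "\<dots> = T s \<otimes>\<^bsub>H\<^esub> T (v \<circ> w)" using simple.IH len by metis
  also have "\<dots> = T (s \<circ> (v \<circ> w))" using total len by (intro T_mult_up[OF s vw]) linarith
  finally show ?case by (simp only: comp_assoc)
qed

lemma T_mult_simple_up:
  assumes "s \<in> simple_reflections r" "w \<in> affine_perms r" "ext_length r (w \<circ> s) = ext_length r w + 1"
  shows "T w \<otimes>\<^bsub>H\<^esub> T s = T (w \<circ> s)"
  using assms ext_length_simple[OF r_pos assms(1)]
  by (intro T_mult_reduced) (simp_all add: simple_in_affine_perms)

text \<open>
  Factor \<open>T w = T (w \<circ> s) T s\<close> and use the quadratic relation for \<open>T s\<close>.
\<close>

lemma T_mult_simple_down:
  assumes s: "s \<in> simple_reflections r" and w: "w \<in> affine_perms r"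
    and down: "ext_length r w = ext_length r (w \<circ> s) + 1"
  shows "T w \<otimes>\<^bsub>H\<^esub> T s = (q \<ominus> \<one>) \<odot>\<^bsub>H\<^esub> T w \<oplus>\<^bsub>H\<^esub> q \<odot>\<^bsub>H\<^esub> T (w \<circ> s)"
proof -
  have ws: "w \<circ> s \<in> affine_perms r" using s w by (rule comp_simple_closed)
  have sG: "s \<in> affine_perms r" using s by (rule simple_in_affine_perms)
  note closed = T_closed[OF w] T_closed[OF ws] T_closed[OF sG]
  have Tw: "T w = T (w \<circ> s) \<otimes>\<^bsub>H\<^esub> T s"
    using T_mult_simple_up[OF s ws] down simple_cancel_right[OF s, of w] by metis
  have "ext_length r (s \<circ> s) < ext_length r s"
    using ext_length_simple[OF r_pos s] ext_length_translation[OF r_pos, of 0] simple_comp_self[OF s]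
    by (simp add: translation_0)
  then have Tss: "T s \<otimes>\<^bsub>H\<^esub> T s = (q \<ominus> \<one>) \<odot>\<^bsub>H\<^esub> T s \<oplus>\<^bsub>H\<^esub> q \<odot>\<^bsub>H\<^esub> \<one>\<^bsub>H\<^esub>"
    using T_mult_down[OF s sG] by (simp only: simple_comp_self[OF s] T_id)
  have "T w \<otimes>\<^bsub>H\<^esub> T s = T (w \<circ> s) \<otimes>\<^bsub>H\<^esub> (T s \<otimes>\<^bsub>H\<^esub> T s)"
    unfolding Tw using closed by (intro m_assoc)
  also have "\<dots> = (q \<ominus> \<one>) \<odot>\<^bsub>H\<^esub> (T (w \<circ> s) \<otimes>\<^bsub>H\<^esub> T s) \<oplus>\<^bsub>H\<^esub> q \<odot>\<^bsub>H\<^esub> T (w \<circ> s)"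
    unfolding Tss using closed
    by (simp add: r_distr smult_closed smult_mult_right R.minus_closed)
  finally show ?thesis unfolding Tw[symmetric] .
qed

lemma coef_mult_T_simple:
  assumes s: "s \<in> simple_reflections r" and h: "h \<in> carrier H" and v: "v \<in> affine_perms r"
  shows "coef (h \<otimes>\<^bsub>H\<^esub> T s) v =
    (if ext_length r (v \<circ> s) < ext_length r v then coef h (v \<circ> s) \<oplus> (q \<ominus> \<one>) \<otimes> coef h v
     else q \<otimes> coef h (v \<circ> s))"
proof -
  let ?down = "\<lambda>w. ext_length r (w \<circ> s) < ext_length r w"
  have Ts: "T s \<in> carrier H" using s by (intro T_closed simple_in_affine_perms)
  have vs: "v \<circ> s \<in> affine_perms r" using s v by (rule comp_simple_closed)
  have basis_eq: "coef (T w \<otimes>\<^bsub>H\<^esub> T s) v =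
      (if ?down v then \<one> else q) \<otimes> coef (T w) (v \<circ> s) \<oplus>
      (if ?down v then q \<ominus> \<one> else \<zero>) \<otimes> coef (T w) v" if w: "w \<in> affine_perms r" for w
  proof -
    have ws: "w \<circ> s \<in> affine_perms r" using s w by (rule comp_simple_closed)
    have iff: "v \<circ> s = w \<longleftrightarrow> v = w \<circ> s" using simple_cancel_right[OF s] by metis
    have ne: "w \<circ> s \<noteq> w" using ext_length_simple_right[OF r_pos w s] by auto
    show ?thesis
    proof (cases "?down w")
      case True
      then have down: "ext_length r w = ext_length r (w \<circ> s) + 1"
        using ext_length_simple_right[OF r_pos w s] by linarith
      have "coef (T w \<otimes>\<^bsub>H\<^esub> T s) v = (q \<ominus> \<one>) \<otimes> coef (T w) v \<oplus> q \<otimes> coef (T (w \<circ> s)) v"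
        unfolding T_mult_simple_down[OF s w down] using v w ws
        by (simp add: coef_add coef_smult T_closed smult_closed)
      moreover have "\<not> ?down v" if "v = w \<circ> s"
        using True unfolding that simple_cancel_right[OF s] by simp
      ultimately show ?thesis using True ne w v vs ws unfolding coef_T[OF w v] coef_T[OF w vs] coef_T[OF ws v] iff
        by (auto simp: R.minus_closed)
    next
      case False
      then have up: "ext_length r (w \<circ> s) = ext_length r w + 1"
        using ext_length_simple_right[OF r_pos w s] by linarith
      have "coef (T w \<otimes>\<^bsub>H\<^esub> T s) v = coef (T (w \<circ> s)) v"
        unfolding T_mult_simple_up[OF s w up] ..
      moreover have "?down v" if "v = w \<circ> s"
        using up unfolding that simple_cancel_right[OF s] by simp
      ultimately show ?thesis using False ne w v vs ws unfolding coef_T[OF w v] coef_T[OF w vs] coef_T[OF ws v] iff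
        by (auto simp: R.minus_closed)
    qed
  qed
  have "coef (h \<otimes>\<^bsub>H\<^esub> T s) v =
      (if ?down v then \<one> else q) \<otimes> coef h (v \<circ> s) \<oplus> (if ?down v then q \<ominus> \<one> else \<zero>) \<otimes> coef h v"
    by (rule coef_linear_map[where L = "\<lambda>h. h \<otimes>\<^bsub>H\<^esub> T s"])
      (use Ts vs v h basis_eq in \<open>auto simp: l_distr smult_mult_left R.minus_closed\<close>)
  then show ?thesis using vs v h by (auto simp: R.minus_closed)
qed

lemma coef_mult_T_translation:
  assumes h: "h \<in> carrier H" and v: "v \<in> affine_perms r"
  shows "coef (h \<otimes>\<^bsub>H\<^esub> T (translation m)) (v \<circ> translation m) = coef h v"
proof -
  have t: "translation m \<in> affine_perms r" by (rule translation_in_affine_perms)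
  have vt: "v \<circ> translation m \<in> affine_perms r" using v t by (rule comp_in_affine_perms)
  have cancel: "(w \<circ> translation m) \<circ> translation (- m) = w" for w :: "int \<Rightarrow> int"
    by (auto simp: translation_def fun_eq_iff)
  have inj: "v \<circ> translation m = w \<circ> translation m \<longleftrightarrow> v = w" for w :: "int \<Rightarrow> int"
    using cancel[of v] cancel[of w] by metis
  have basis_eq: "coef (T w \<otimes>\<^bsub>H\<^esub> T (translation m)) (v \<circ> translation m) =
      \<one> \<otimes> coef (T w) v \<oplus> \<zero> \<otimes> coef (T w) (v \<circ> translation m)" if w: "w \<in> affine_perms r" for w
  proof -
    have "T w \<otimes>\<^bsub>H\<^esub> T (translation m) = T (w \<circ> translation m)"
      using w t ext_length_translation[OF r_pos] ext_length_translation_right[OF r_pos w]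
      by (intro T_mult_reduced) auto
    then show ?thesis using w v vt inj comp_in_affine_perms[OF w t] by (simp add: coef_T)
  qed
  have "coef (h \<otimes>\<^bsub>H\<^esub> T (translation m)) (v \<circ> translation m) =
      \<one> \<otimes> coef h v \<oplus> \<zero> \<otimes> coef h (v \<circ> translation m)"
    by (rule coef_linear_map[where L = "\<lambda>h. h \<otimes>\<^bsub>H\<^esub> T (translation m)"])
      (use T_closed[OF t] vt v h basis_eq in \<open>auto simp: l_distr smult_mult_left\<close>)
  then show ?thesis using vt v h by simp
qed

end

section \<open>Cosets of the finite symmetric group\<close>

definition fin_coset :: "nat \<Rightarrow> (int \<Rightarrow> int) \<Rightarrow> (int \<Rightarrow> int) set" where
  "fin_coset r y = (\<lambda>u. u \<circ> y) ` fin_sym r"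

lemma fin_coset_self: "y \<in> fin_coset r y"
  unfolding fin_coset_def using fin_sym_id by (metis id_comp image_eqI)

text \<open>
  The function \<open>f\<close> is right multiplication by the inverse of \<open>g\<close>; keeping it abstract serves
  reflections and translations alike.
\<close>

lemma fin_coset_comp_iff:
  assumes "\<And>v. f v \<circ> g = v" "\<And>v. f (v \<circ> g) = v"
  shows "f v \<in> fin_coset r y \<longleftrightarrow> v \<in> fin_coset r (y \<circ> g)"
proof
  assume "f v \<in> fin_coset r y"
  then obtain u where u: "u \<in> fin_sym r" "f v = u \<circ> y" by (auto simp: fin_coset_def)
  have "v = u \<circ> (y \<circ> g)" using assms(1)[of v] u(2) by (metis comp_assoc)
  then show "v \<in> fin_coset r (y \<circ> g)" using u(1) by (auto simp: fin_coset_def)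
next
  assume "v \<in> fin_coset r (y \<circ> g)"
  then obtain u where u: "u \<in> fin_sym r" "v = u \<circ> (y \<circ> g)" by (auto simp: fin_coset_def)
  have "f v = u \<circ> y" using assms(2)[of "u \<circ> y"] u(2) by (metis comp_assoc)
  then show "f v \<in> fin_coset r y" using u(1) by (auto simp: fin_coset_def)
qed

lemma fin_coset_comp_simple_iff:
  "s \<in> simple_reflections r \<Longrightarrow> v \<circ> s \<in> fin_coset r y \<longleftrightarrow> v \<in> fin_coset r (y \<circ> s)"
  using fin_coset_comp_iff[of "\<lambda>v. v \<circ> s" s v r y] by (simp only: simple_cancel_right)

lemma fin_coset_comp_translation_iff:
  "v \<circ> translation (- m) \<in> fin_coset r y \<longleftrightarrow> v \<in> fin_coset r (y \<circ> translation m)"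
  by (rule fin_coset_comp_iff[of "\<lambda>v. v \<circ> translation (- m)"])
    (auto simp: translation_def fun_eq_iff)

lemma fin_sym_comp_cancel:
  assumes "u \<in> fin_sym r" "v \<in> affine_perms r"
  shows "u \<circ> v \<in> fin_coset r y \<longleftrightarrow> v \<in> fin_coset r y"
proof -
  have bij: "bij u" using assms(1) by (simp add: fin_sym_def affine_perms_iff)
  have inv: "inv_into UNIV u \<circ> (u \<circ> v) = v"
    using bij by (simp add: fun_eq_iff bij_is_inj)
  show ?thesis
    unfolding fin_coset_def
  proof (intro iffI; elim imageE)
    fix u' assume "u \<circ> v = u' \<circ> y" "u' \<in> fin_sym r"
    then have "v = (inv_into UNIV u \<circ> u') \<circ> y" using inv by (metis comp_assoc)
    then show "v \<in> (\<lambda>u. u \<circ> y) ` fin_sym r"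
      using fin_sym_comp[OF fin_sym_inv[OF assms(1)] \<open>u' \<in> fin_sym r\<close>] by blast
  next
    fix u' assume "v = u' \<circ> y" "u' \<in> fin_sym r"
    then have "u \<circ> v = (u \<circ> u') \<circ> y" by (simp only: comp_assoc)
    then show "u \<circ> v \<in> (\<lambda>u. u \<circ> y) ` fin_sym r"
      using fin_sym_comp[OF assms(1) \<open>u' \<in> fin_sym r\<close>] by blast
  qed
qed

text \<open>
  A permutation of \<open>{1..r}\<close>, extended periodically, preserves each of the blocks
  \<open>{k r + 1..k r + r}\<close>.
\<close>

lemma fin_sym_div:
  assumes "1 \<le> r" "u \<in> fin_sym r"
  shows "(u j - 1) div int r = (j - 1) div int r"
proof -
  define i where "i = (j - 1) mod int r + 1"
  define k where "k = (j - 1) div int r"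
  have i: "i \<in> {1..int r}" using assms by (auto simp: i_def intro: add1_zle_eq[THEN iffD2])
  have j: "j = i + k * int r"
    unfolding i_def k_def using div_mult_mod_eq[of "j - 1" "int r"] by linarith
  have "u j - 1 = (u i - 1) + k * int r"
    using affine_perms_periodic[OF fin_sym_subset[OF assms(2)], of i k] j by simp
  moreover have "(u i - 1) div int r = 0" using fin_sym_range[OF assms(2) i] by simp
  moreover have "((u i - 1) + k * int r) div int r = (u i - 1) div int r + k" using assms(1) by simp
  ultimately show ?thesis by (simp only: k_def)
qed

text \<open>
  The element of the translation lattice that moves the residue class of \<open>c\<close>, for
  \<open>0 \<le> c < r\<close>, by \<open>c M\<close> blocks of length \<open>r\<close>: the displacements of two different classes differ by
  \<open>\<bar>M\<bar>\<close> blocks or more.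
\<close>

definition spread :: "nat \<Rightarrow> int \<Rightarrow> int \<Rightarrow> int" where
  "spread r M j = j + (M * (j mod int r)) * int r"

lemma spread_mod: "spread r M j mod int r = j mod int r"
  unfolding spread_def by (rule mod_mult_self1)

lemma spread_in_affine_perms: "spread r M \<in> affine_perms r"
proof -
  have cancel: "spread r (- L) (spread r L j) = j" for L j
    unfolding spread_def[of r "- L"] spread_mod by (simp add: spread_def)
  then have "spread r L (spread r (- L) j) = j" for L j
    using cancel[of "- L" j] by simp
  with cancel   have "bij (spread r M)"
    by (intro bij_betw_byWitness[where f' = "spread r (- M)"]) auto
  then show ?thesis by (simp add: affine_perms_iff spread_def)
qed

text \<open>
  If the cosets agree then, for every \<open>i\<close>, the points \<open>w i\<close> and \<open>w' i\<close> are sent to the same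
  block by \<open>spread r M\<close>. As they are at distance at most \<open>2 N\<close>, they start at most \<open>2 N < M\<close> blocks
  apart, so they must have been moved by the same number of blocks. Hence they have the
  same residue and lie in the same block, that is, they are equal.
\<close>

lemma spread_separates:
  assumes r: "1 \<le> r"
    and "\<And>j. \<bar>w j - j\<bar> \<le> N" "\<And>j. \<bar>w' j - j\<bar> \<le> N" and M: "2 * N < M"
    and coset: "spread r M \<circ> w \<in> fin_coset r (spread r M \<circ> w')"
  shows "w = w'"
proof
  fix i
  let ?a = "w i" and ?b = "w' i" and ?r = "int r"
  obtain u where u: "u \<in> fin_sym r" "spread r M \<circ> w = u \<circ> (spread r M \<circ> w')"
    using coset by (auto simp: fin_coset_def)
  then have "spread r M ?a = u (spread r M ?b)" by (metis comp_apply)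
  then have eq: "(spread r M ?a - 1) div ?r = (spread r M ?b - 1) div ?r"
    using fin_sym_div[OF r u(1)] by simp
  have spread_div: "(spread r M j - 1) div ?r = (j - 1) div ?r + M * (j mod ?r)" for j
  proof -
    have "spread r M j - 1 = (j - 1) + (M * (j mod ?r)) * ?r" by (simp add: spread_def)
    moreover have "((j - 1) + (M * (j mod ?r)) * ?r) div ?r = (j - 1) div ?r + M * (j mod ?r)"
      using r by simp
    ultimately show ?thesis by (simp only:)
  qed
  define d where "d = ?a mod ?r - ?b mod ?r"
  have Md: "M * d = (?b - 1) div ?r - (?a - 1) div ?r"
    using eq unfolding spread_div d_def by (simp add: algebra_simps)
  have div_diff: "x div ?r - y div ?r \<le> x - y \<and> 0 \<le> x div ?r - y div ?r" if "y \<le> x" for x y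
  proof -
    have "(x - y) * 1 \<le> (x - y) * ?r" using that r by (intro mult_left_mono) auto
    then have "x div ?r \<le> (y + (x - y) * ?r) div ?r"
      using r by (intro zdiv_mono1) auto
    then show ?thesis using that r by (simp add: zdiv_mono1)
  qed
  have "\<bar>?a - ?b\<bar> \<le> 2 * N" using assms(2)[of i] assms(3)[of i] by linarith
  then have "\<bar>M * d\<bar> \<le> 2 * N"
    unfolding Md using div_diff[of "?a - 1" "?b - 1"] div_diff[of "?b - 1" "?a - 1"] by linarith
  have "d = 0"
  proof (rule ccontr)
    assume "d \<noteq> 0"
    then have "M * 1 \<le> M * \<bar>d\<bar>"
      using M assms(2)[of i] by (intro mult_left_mono) linarith+
    moreover have "M * \<bar>d\<bar> \<le> \<bar>M * d\<bar>" by (simp add: abs_mult mult_right_mono)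
    ultimately show False using \<open>\<bar>M * d\<bar> \<le> 2 * N\<close> M by linarith
  qed
  then have "(?a - 1) div ?r = (?b - 1) div ?r" using Md by simp
  moreover have "(?a - 1) mod ?r = (?b - 1) mod ?r"
    using \<open>d = 0\<close> by (metis d_def eq_iff_diff_eq_0 mod_diff_left_eq)
  ultimately have "?a - 1 = ?b - 1" by (metis div_mult_mod_eq)
  then show "w i = w' i" by simp
qed

section \<open>The right ideal generated by the symmetrizer\<close>

context affine_hecke_unit
begin

definition sym_sum :: 'h where
  "sym_sum = (\<Oplus>\<^bsub>H\<^esub>w\<in>fin_sym r. T w)"

definition left_invariant :: "'h \<Rightarrow> bool" where
  "left_invariant h \<longleftrightarrow> (\<forall>u\<in>fin_sym r. \<forall>v\<in>affine_perms r. coef h (u \<circ> v) = coef h v)"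

lemma sym_sum_closed: "sym_sum \<in> carrier H"
  unfolding sym_sum_def by (intro finsum_closed) (auto intro: T_closed fin_sym_subset)

lemma coef_sym_sum:
  assumes "v \<in> affine_perms r"
  shows "coef sym_sum v = (if v \<in> fin_sym r then \<one> else \<zero>)"
proof -
  have "sym_sum = (\<Oplus>\<^bsub>H\<^esub>w\<in>fin_sym r. \<one> \<odot>\<^bsub>H\<^esub> T w)"
    unfolding sym_sum_def by (intro finsum_cong) (auto simp: T_closed fin_sym_subset simp_implies_def)
  moreover have "fin_sym r \<subseteq> affine_perms r" using fin_sym_subset by blast
  ultimately show ?thesis
    using coef_finsum[of "fin_sym r" "\<lambda>_. \<one>" v] finite_fin_sym[OF r_pos] assms by simp
qed

lemma left_invariant_sym_sum: "left_invariant sym_sum"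
  unfolding left_invariant_def
proof (intro ballI)
  fix u v assume u: "u \<in> fin_sym r" and v: "v \<in> affine_perms r"
  have coset: "fin_coset r id = fin_sym r" by (simp add: fin_coset_def)
  have "u \<circ> v \<in> affine_perms r" using fin_sym_subset[OF u] v by (rule comp_in_affine_perms)
  then show "coef sym_sum (u \<circ> v) = coef sym_sum v"
    using fin_sym_comp_cancel[OF u v, of id] v unfolding coset by (simp add: coef_sym_sum)
qed

lemma add_minus_one_mult:
  assumes "a \<in> carrier K" "b \<in> carrier K"
  shows "a \<oplus> (b \<ominus> \<one>) \<otimes> a = b \<otimes> a"
proof -
  have "(b \<ominus> \<one>) \<otimes> a = b \<otimes> a \<oplus> \<ominus> a"
    using assms by (simp add: R.minus_eq R.l_distr R.l_minus)
  then have "a \<oplus> (b \<ominus> \<one>) \<otimes> a = (a \<oplus> \<ominus> a) \<oplus> b \<otimes> a"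
    using assms by (simp add: R.a_ac)
  then show ?thesis using assms by (simp add: R.r_neg)
qed

text \<open>
  Together with the converse \<open>eigen_left_invariant\<close> this turns a condition on coefficients
  into one that involves left multiplications only, and is therefore visibly stable under right
  multiplication.
\<close>

lemma left_invariant_eigen:
  assumes h: "h \<in> carrier H" and inv: "left_invariant h" and i: "2 \<le> r" "1 \<le> i" "i < int r"
  shows "T (simple_reflection r i) \<otimes>\<^bsub>H\<^esub> h = q \<odot>\<^bsub>H\<^esub> h"
proof (rule coef_eqI)
  let ?s = "simple_reflection r i"
  have s: "?s \<in> simple_reflections r" using i(1) by (rule simple_reflection_in_simple_reflections)
  have sf: "?s \<in> fin_sym r" using i by (rule simple_reflection_in_fin_sym)
  have "T ?s \<in> carrier H" using s by (intro T_closed simple_in_affine_perms)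
  then show "T ?s \<otimes>\<^bsub>H\<^esub> h \<in> carrier H" "q \<odot>\<^bsub>H\<^esub> h \<in> carrier H" using h by (auto simp: smult_closed)
  fix v assume v: "v \<in> affine_perms r"
  have "coef h (?s \<circ> v) = coef h v" using inv sf v by (simp add: left_invariant_def)
  then show "coef (T ?s \<otimes>\<^bsub>H\<^esub> h) v = coef (q \<odot>\<^bsub>H\<^esub> h) v"
    using h v by (simp add: coef_T_simple_mult[OF s h v] coef_smult add_minus_one_mult)
qed

text \<open>
  For each finite simple reflection \<open>s\<close>, comparing coefficients at the shorter of
  \<open>v\<close> and \<open>s \<circ> v\<close> gives \<open>q c = q c'\<close> for the two coefficients, and \<open>q\<close>
  is a unit. These reflections generate the finite symmetric group.
\<close>

lemma eigen_left_invariant: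
  assumes h: "h \<in> carrier H"
    and eigen: "\<And>i. \<lbrakk>2 \<le> r; 1 \<le> i; i < int r\<rbrakk> \<Longrightarrow> T (simple_reflection r i) \<otimes>\<^bsub>H\<^esub> h = q \<odot>\<^bsub>H\<^esub> h"
  shows "left_invariant h"
proof -
  have simple: "coef h (simple_reflection r i \<circ> v) = coef h v"
    if i: "2 \<le> r" "1 \<le> i" "i < int r" and v: "v \<in> affine_perms r" for i v
  proof -
    let ?s = "simple_reflection r i"
    have s: "?s \<in> simple_reflections r" using i(1) by (rule simple_reflection_in_simple_reflections)
    have sv: "?s \<circ> v \<in> affine_perms r" using s v by (rule simple_comp_closed)
    have up: "coef h (?s \<circ> w) = coef h w"
      if "w \<in> affine_perms r" "\<not> ext_length r (?s \<circ> w) < ext_length r w" for w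
    proof -
      have "q \<otimes> coef h (?s \<circ> w) = q \<otimes> coef h w"
        using coef_T_simple_mult[OF s h that(1)] that h eigen[OF i] by (simp add: coef_smult)
      then show ?thesis
        using R.Units_l_cancel[OF q_unit] coef_closed[OF h simple_comp_closed[OF s that(1)]]
          coef_closed[OF h that(1)] by blast
    qed
    show ?thesis
    proof (cases "ext_length r (?s \<circ> v) < ext_length r v")
      case True
      then show ?thesis using up[OF sv] simple_cancel_left[OF s, of v] by simp
    next
      case False
      then show ?thesis using up[OF v] by simp
    qed
  qed
  have "\<forall>v\<in>affine_perms r. coef h (u \<circ> v) = coef h v" if "u \<in> fin_sym r" for u
    using r_pos that
  proof (induction u rule: fin_sym_induct)
    case id
    show ?case by (simp only: id_comp) blast
  next
    case (comp u i)
    show ?case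
    proof
      fix v assume v: "v \<in> affine_perms r"
      let ?s = "simple_reflection r i"
      have "?s \<circ> v \<in> affine_perms r"
        using v comp.hyps by (intro simple_comp_closed simple_reflection_in_simple_reflections) auto
      then have "coef h (u \<circ> (?s \<circ> v)) = coef h (?s \<circ> v)" using comp.IH by metis
      also have "\<dots> = coef h v" using comp.hyps v by (intro simple)
      finally show "coef h ((u \<circ> ?s) \<circ> v) = coef h v" by (simp only: comp_assoc)
    qed
  qed
  then show ?thesis by (simp add: left_invariant_def)
qed

lemma left_invariant_mult:
  assumes "h \<in> carrier H" "left_invariant h" "g \<in> carrier H"
  shows "left_invariant (h \<otimes>\<^bsub>H\<^esub> g)"
proof (rule eigen_left_invariant)
  show "h \<otimes>\<^bsub>H\<^esub> g \<in> carrier H" using assms by simp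
  fix i assume i: "2 \<le> r" "1 \<le> i" "i < int r"
  let ?s = "simple_reflection r i"
  have "T ?s \<in> carrier H"
    using i by (intro T_closed simple_in_affine_perms simple_reflection_in_simple_reflections)
  then have "T ?s \<otimes>\<^bsub>H\<^esub> (h \<otimes>\<^bsub>H\<^esub> g) = (T ?s \<otimes>\<^bsub>H\<^esub> h) \<otimes>\<^bsub>H\<^esub> g"
    using assms by (simp add: m_assoc)
  then show "T ?s \<otimes>\<^bsub>H\<^esub> (h \<otimes>\<^bsub>H\<^esub> g) = q \<odot>\<^bsub>H\<^esub> (h \<otimes>\<^bsub>H\<^esub> g)"
    using left_invariant_eigen[OF assms(1,2) i] assms by (simp add: smult_mult_left)
qed

definition sym_ideal :: "'h set" where
  "sym_ideal = {sym_sum \<otimes>\<^bsub>H\<^esub> g | g. g \<in> carrier H}"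

lemma sym_ideal_closed: "t \<in> sym_ideal \<Longrightarrow> t \<in> carrier H"
  using sym_sum_closed by (auto simp: sym_ideal_def)

lemma sym_ideal_left_invariant: "t \<in> sym_ideal \<Longrightarrow> left_invariant t"
  using sym_sum_closed left_invariant_sym_sum left_invariant_mult by (auto simp: sym_ideal_def)

lemma sym_sum_in_sym_ideal: "sym_sum \<in> sym_ideal"
  unfolding sym_ideal_def using sym_sum_closed by (auto intro!: exI[of _ "\<one>\<^bsub>H\<^esub>"])

lemma sym_ideal_mult: "\<lbrakk>t \<in> sym_ideal; h \<in> carrier H\<rbrakk> \<Longrightarrow> t \<otimes>\<^bsub>H\<^esub> h \<in> sym_ideal"
  using sym_sum_closed by (auto simp: sym_ideal_def m_assoc)

lemma sym_ideal_combination: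
  assumes "s \<in> sym_ideal" "t \<in> sym_ideal" "a \<in> carrier K" "b \<in> carrier K"
  shows "a \<odot>\<^bsub>H\<^esub> s \<oplus>\<^bsub>H\<^esub> b \<odot>\<^bsub>H\<^esub> t \<in> sym_ideal"
proof -
  obtain g h where "g \<in> carrier H" "h \<in> carrier H" "s = sym_sum \<otimes>\<^bsub>H\<^esub> g" "t = sym_sum \<otimes>\<^bsub>H\<^esub> h"
    using assms by (auto simp: sym_ideal_def)
  then have "a \<odot>\<^bsub>H\<^esub> s \<oplus>\<^bsub>H\<^esub> b \<odot>\<^bsub>H\<^esub> t = sym_sum \<otimes>\<^bsub>H\<^esub> (a \<odot>\<^bsub>H\<^esub> g \<oplus>\<^bsub>H\<^esub> b \<odot>\<^bsub>H\<^esub> h)"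
    "a \<odot>\<^bsub>H\<^esub> g \<oplus>\<^bsub>H\<^esub> b \<odot>\<^bsub>H\<^esub> h \<in> carrier H"
    using assms sym_sum_closed by (auto simp: r_distr smult_mult_right smult_closed)
  then show ?thesis unfolding sym_ideal_def by blast
qed

text \<open>
  The sum of \<open>T v\<close> over the coset of \<open>y\<close>, described by its coefficients because products
  with \<open>T s\<close> are known coefficientwise, and required to lie in the ideal.
\<close>

definition coset_sum :: "(int \<Rightarrow> int) \<Rightarrow> 'h \<Rightarrow> bool" where
  "coset_sum y t \<longleftrightarrow> t \<in> sym_ideal \<and>
     (\<forall>v\<in>affine_perms r. coef t v = (if v \<in> fin_coset r y then \<one> else \<zero>))"

lemma coset_sum_translation: "coset_sum (translation m) (sym_sum \<otimes>\<^bsub>H\<^esub> T (translation m))"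
  unfolding coset_sum_def
proof (intro conjI ballI)
  show "sym_sum \<otimes>\<^bsub>H\<^esub> T (translation m) \<in> sym_ideal"
    by (intro sym_ideal_mult sym_sum_in_sym_ideal T_closed translation_in_affine_perms)
  fix v assume v: "v \<in> affine_perms r"
  define w where "w = v \<circ> translation (- m)"
  have w: "w \<in> affine_perms r"
    unfolding w_def using v translation_in_affine_perms by (rule comp_in_affine_perms)
  have vw: "v = w \<circ> translation m" by (auto simp: w_def translation_def fun_eq_iff)
  have "fin_coset r id = fin_sym r" by (simp add: fin_coset_def)
  then have "w \<in> fin_sym r \<longleftrightarrow> v \<in> fin_coset r (translation m)"
    using fin_coset_comp_translation_iff[of v m r id] unfolding w_def id_comp by metis
  then show "coef (sym_sum \<otimes>\<^bsub>H\<^esub> T (translation m)) v = (if v \<in> fin_coset r (translation m) then \<one> else \<zero>)"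
    using coef_mult_T_translation[OF sym_sum_closed w, of m] coef_sym_sum[OF w] unfolding vw[symmetric] by simp
qed

text \<open>
  If right multiplication by \<open>s\<close> moves the coset \<open>D\<close> of \<open>v\<close>, then \<open>t T s\<close> is constant
  on each of \<open>D\<close> and \<open>D s\<close> and zero elsewhere, with a unit as value on \<open>D s\<close>. So
  a multiple of \<open>t\<close> can be subtracted and the result normalised. By invariance each of the
  two values may be computed at a single representative.
\<close>

lemma coset_sum_step:
  assumes t: "coset_sum v t" and v: "v \<in> affine_perms r" and s: "s \<in> simple_reflections r"
  shows "\<exists>t'. coset_sum (v \<circ> s) t'"
proof (cases "v \<circ> s \<in> fin_coset r v")
  case True
  then obtain u where u: "u \<in> fin_sym r" "v \<circ> s = u \<circ> v" by (auto simp: fin_coset_def)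
  have "w \<in> fin_coset r (v \<circ> s) \<longleftrightarrow> w \<in> fin_coset r v" for w
  proof
    assume "w \<in> fin_coset r (v \<circ> s)"
    then obtain u' where "u' \<in> fin_sym r" "w = u' \<circ> (u \<circ> v)"
      unfolding u(2) by (auto simp: fin_coset_def)
    then show "w \<in> fin_coset r v"
      unfolding fin_coset_def using fin_sym_comp[OF _ u(1)] by (metis comp_assoc image_eqI)
  next
    assume "w \<in> fin_coset r v"
    then obtain u' where u': "u' \<in> fin_sym r" "w = u' \<circ> v" by (auto simp: fin_coset_def)
    have "inv_into UNIV u \<circ> (u \<circ> v) = v"
      using u(1) by (simp add: fun_eq_iff fin_sym_def affine_perms_iff bij_is_inj)
    then have "w = (u' \<circ> inv_into UNIV u) \<circ> (u \<circ> v)" unfolding u'(2) by (metis comp_assoc)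
    then show "w \<in> fin_coset r (v \<circ> s)"
      unfolding fin_coset_def u(2) using fin_sym_comp[OF u'(1) fin_sym_inv[OF u(1)]] by blast
  qed
  then show ?thesis using t unfolding coset_sum_def by metis
next
  case False
  have tJ: "t \<in> sym_ideal" and coef_t: "\<And>w. w \<in> affine_perms r \<Longrightarrow> coef t w = (if w \<in> fin_coset r v then \<one> else \<zero>)"
    using t by (auto simp: coset_sum_def)
  have tH: "t \<in> carrier H" using tJ by (rule sym_ideal_closed)
  have Ts: "T s \<in> carrier H" using s by (intro T_closed simple_in_affine_perms)
  have vs: "v \<circ> s \<in> affine_perms r" using s v by (rule comp_simple_closed)
  have tTs: "t \<otimes>\<^bsub>H\<^esub> T s \<in> sym_ideal" using tJ Ts by (rule sym_ideal_mult)
  define a where "a = coef (t \<otimes>\<^bsub>H\<^esub> T s) v"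
  define b where "b = coef (t \<otimes>\<^bsub>H\<^esub> T s) (v \<circ> s)"
  have a: "a \<in> carrier K" unfolding a_def using tTs v by (intro coef_closed sym_ideal_closed)
  have "b = (if ext_length r v < ext_length r (v \<circ> s) then \<one> else q)"
    unfolding b_def coef_mult_T_simple[OF s tH vs] simple_cancel_right[OF s]
    using coef_t[OF v] coef_t[OF vs] False fin_coset_self by (simp add: R.minus_closed)
  then have b: "b \<in> Units K" using q_unit by simp
  define b' where "b' = inv b"
  have b': "b' \<in> carrier K" "b' \<otimes> b = \<one>" and bK: "b \<in> carrier K" using b by (auto simp: b'_def)
  \<comment> \<open>The values of \<open>t T s\<close> are \<open>a\<close> on the coset of \<open>v\<close> and \<open>b\<close> on that of \<open>v \<circ> s\<close>.\<close>
  define t' where "t' = b' \<odot>\<^bsub>H\<^esub> (t \<otimes>\<^bsub>H\<^esub> T s) \<oplus>\<^bsub>H\<^esub> (\<ominus> (b' \<otimes> a)) \<odot>\<^bsub>H\<^esub> t"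
  have t'J: "t' \<in> sym_ideal"
    unfolding t'_def using tTs tJ a b' by (intro sym_ideal_combination) auto
  have coef_t': "coef t' w = b' \<otimes> coef (t \<otimes>\<^bsub>H\<^esub> T s) w \<ominus> (b' \<otimes> a) \<otimes> coef t w"
    if "w \<in> affine_perms r" for w
    unfolding t'_def using that tTs tJ tH Ts a b'
    by (simp add: coef_add coef_smult smult_closed R.l_minus R.minus_eq)
  have inv: "coef t' (u \<circ> w) = coef t' w" if "u \<in> fin_sym r" "w \<in> affine_perms r" for u w
    using sym_ideal_left_invariant[OF t'J] that by (simp add: left_invariant_def)
  have at_v: "coef t' v = \<zero>"
    using coef_t'[OF v] coef_t[OF v] fin_coset_self a b' by (simp add: a_def[symmetric] R.minus_eq R.r_neg)
  have at_vs: "coef t' (v \<circ> s) = \<one>"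
    using coef_t'[OF vs] coef_t[OF vs] False a b' by (simp add: b_def[symmetric] R.minus_eq)
  have "coef t' w = (if w \<in> fin_coset r (v \<circ> s) then \<one> else \<zero>)" if w: "w \<in> affine_perms r" for w
  proof (cases "w \<in> fin_coset r (v \<circ> s)")
    case True
    then obtain u where "u \<in> fin_sym r" "w = u \<circ> (v \<circ> s)" by (auto simp: fin_coset_def)
    then show ?thesis using inv[OF _ vs] at_vs True by simp
  next
    case notin: False
    show ?thesis
    proof (cases "w \<in> fin_coset r v")
      case True
      then obtain u where "u \<in> fin_sym r" "w = u \<circ> v" by (auto simp: fin_coset_def)
      then show ?thesis using inv[OF _ v] at_v notin by simp
    next
      case False
      have ws: "w \<circ> s \<in> affine_perms r" using s w by (rule comp_simple_closed)
      have "coef t w = \<zero>" using coef_t[OF w] False by simp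
      moreover have "coef t (w \<circ> s) = \<zero>"
        using coef_t[OF ws] notin fin_coset_comp_simple_iff[OF s, of w v] by simp
      ultimately have "coef (t \<otimes>\<^bsub>H\<^esub> T s) w = \<zero>"
        unfolding coef_mult_T_simple[OF s tH w] by (simp add: R.minus_closed)
      then show ?thesis
        using coef_t'[OF w] \<open>coef t w = \<zero>\<close> notin a b' by (simp add: R.minus_eq)
    qed
  qed
  then show ?thesis using t'J unfolding coset_sum_def by blast
qed

lemma coset_sum_exists:
  assumes "v \<in> affine_perms r"
  obtains t where "coset_sum v t"
proof -
  obtain m ss where ss: "set ss \<subseteq> simple_reflections r" and v: "v = translation m \<circ> word ss"
    by (rule affine_perm_factor[OF r_pos assms])
  from ss have "\<exists>t. coset_sum (translation m \<circ> word ss) t"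
  proof (induction ss rule: rev_induct)
    case Nil
    then show ?case using coset_sum_translation by (metis comp_id word_Nil)
  next
    case (snoc s ss)
    have s: "s \<in> simple_reflections r" and ss: "set ss \<subseteq> simple_reflections r"
      using snoc.prems by auto
    have eq: "translation m \<circ> word (ss @ [s]) = (translation m \<circ> word ss) \<circ> s"
      unfolding word_append word_Cons word_Nil by (simp only: comp_assoc comp_id)
    have "translation m \<circ> word ss \<in> affine_perms r"
      using translation_in_affine_perms word_in_affine_perms[OF ss] by (rule comp_in_affine_perms)
    moreover obtain t where "coset_sum (translation m \<circ> word ss) t" using snoc.IH[OF ss] by blast
    ultimately show ?case unfolding eq using s by (intro coset_sum_step)
  qed
  then show thesis using that v by blast
qed

section \<open>Leading terms and faithfulness\<close>

text \<open>
  The product of the coset sum \<open>t\<close> of \<open>y\<close> with \<open>T w\<close> has a unit as coefficient at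
  \<open>y \<circ> w\<close>, and outside the coset of \<open>y \<circ> w\<close> it involves only cosets of \<open>y \<circ> w'\<close> with \<open>w'\<close> shorter than
  \<open>w\<close>. The displacement of the \<open>w'\<close> is bounded by \<open>n\<close>, which is what makes
  \<open>spread_separates\<close> applicable to them.
\<close>

definition leading_term :: "(int \<Rightarrow> int) \<Rightarrow> 'h \<Rightarrow> int \<Rightarrow> (int \<Rightarrow> int) \<Rightarrow> bool" where
  "leading_term y t n w \<longleftrightarrow> coef (t \<otimes>\<^bsub>H\<^esub> T w) (y \<circ> w) \<in> Units K \<and>
     (\<forall>v\<in>affine_perms r. coef (t \<otimes>\<^bsub>H\<^esub> T w) v \<noteq> \<zero> \<longrightarrow>
       (\<exists>w'\<in>affine_perms r. v \<in> fin_coset r (y \<circ> w') \<and> (\<forall>j. \<bar>w' j - j\<bar> \<le> n) \<and>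
         (w' = w \<or> ext_length r w' < ext_length r w)))"

lemma leading_term_translation:
  assumes t: "coset_sum y t" and y: "y \<in> affine_perms r"
  shows "leading_term y t \<bar>m\<bar> (translation m)"
proof -
  have tH: "t \<in> carrier H" using t by (auto simp: coset_sum_def intro: sym_ideal_closed)
  have coef_t: "coef t w = (if w \<in> fin_coset r y then \<one> else \<zero>)" if "w \<in> affine_perms r" for w
    using t that by (simp add: coset_sum_def)
  have "coef (t \<otimes>\<^bsub>H\<^esub> T (translation m)) (y \<circ> translation m) = \<one>"
    using coef_mult_T_translation[OF tH y] coef_t[OF y] fin_coset_self by simp
  moreover have "v \<in> fin_coset r (y \<circ> translation m)"
    if v: "v \<in> affine_perms r" and ne: "coef (t \<otimes>\<^bsub>H\<^esub> T (translation m)) v \<noteq> \<zero>" for v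
  proof -
    define w where "w = v \<circ> translation (- m)"
    have w: "w \<in> affine_perms r"
      unfolding w_def using v translation_in_affine_perms by (rule comp_in_affine_perms)
    have vw: "v = w \<circ> translation m" by (auto simp: w_def translation_def fun_eq_iff)
    have "w \<in> fin_coset r y"
      using coef_mult_T_translation[OF tH w, of m] coef_t[OF w] ne unfolding vw by (auto split: if_splits)
    then show ?thesis using fin_coset_comp_translation_iff unfolding w_def by blast
  qed
  ultimately show ?thesis
    unfolding leading_term_def using translation_in_affine_perms
    by (auto simp: translation_def intro!: bexI[of _ "translation m"])
qed

text \<open>
  Right multiplication by \<open>T s\<close> takes the coset of \<open>y \<circ> w'\<close> to itself and to that of
  \<open>y \<circ> w' \<circ> s\<close>, so the bounds on lengths and displacements grow by one. The unit survives because the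
  coset of \<open>y \<circ> w \<circ> s\<close> did not occur before: by separation it would have to belong to an
  element that is not longer than \<open>w\<close>.
\<close>

lemma leading_term_step:
  assumes lead: "leading_term y t n w" and t: "t \<in> carrier H" and y: "y \<in> affine_perms r"
    and w: "w \<in> affine_perms r" and s: "s \<in> simple_reflections r"
    and up: "ext_length r (w \<circ> s) = ext_length r w + 1"
    and disp: "\<And>j. \<bar>w j - j\<bar> \<le> n"
    and sep: "\<And>w w'. \<lbrakk>\<And>j. \<bar>w j - j\<bar> \<le> n + 1; \<And>j. \<bar>w' j - j\<bar> \<le> n + 1;
          y \<circ> w \<in> fin_coset r (y \<circ> w')\<rbrakk> \<Longrightarrow> w = w'"
  shows "leading_term y t (n + 1) (w \<circ> s)"
proof -
  let ?g = "t \<otimes>\<^bsub>H\<^esub> T w"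
  have sG: "s \<in> affine_perms r" using s by (rule simple_in_affine_perms)
  have g: "?g \<in> carrier H" using t w by (simp add: T_closed)
  have prod: "t \<otimes>\<^bsub>H\<^esub> T (w \<circ> s) = ?g \<otimes>\<^bsub>H\<^esub> T s"
    unfolding T_mult_simple_up[OF s w up, symmetric]
    using t T_closed[OF w] T_closed[OF sG] by (simp add: m_assoc)
  have s_disp: "\<bar>s j - j\<bar> \<le> 1" for j
    using word_displacement[of "[s]" r j] s by simp
  have unit: "coef ?g (y \<circ> w) \<in> Units K"
    and supp: "\<And>v. \<lbrakk>v \<in> affine_perms r; coef ?g v \<noteq> \<zero>\<rbrakk> \<Longrightarrow>
       \<exists>w'\<in>affine_perms r. v \<in> fin_coset r (y \<circ> w') \<and> (\<forall>j. \<bar>w' j - j\<bar> \<le> n) \<and>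
         (w' = w \<or> ext_length r w' < ext_length r w)"
    using lead by (auto simp: leading_term_def)
  have yw: "y \<circ> w \<in> affine_perms r" using y w by (rule comp_in_affine_perms)
  have yws: "y \<circ> (w \<circ> s) \<in> affine_perms r" using y comp_simple_closed[OF s w] by (rule comp_in_affine_perms)
  have ws_disp: "\<bar>(w \<circ> s) j - j\<bar> \<le> n + 1" for j
    using disp[of "s j"] s_disp[of j] by (simp add: abs_if split: if_splits)
  have zero: "coef ?g (y \<circ> (w \<circ> s)) = \<zero>"
  proof (rule ccontr)
    assume "coef ?g (y \<circ> (w \<circ> s)) \<noteq> \<zero>"
    then obtain w' where w': "y \<circ> (w \<circ> s) \<in> fin_coset r (y \<circ> w')" "\<And>j. \<bar>w' j - j\<bar> \<le> n"
      "w' = w \<or> ext_length r w' < ext_length r w"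
      using supp[OF yws] by blast
    have "\<bar>w' j - j\<bar> \<le> n + 1" for j using w'(2)[of j] by linarith
    then have "w \<circ> s = w'" using sep[OF ws_disp _ w'(1)] by blast
    then show False using w'(3) up by auto
  qed
  have cancel: "y \<circ> (w \<circ> s) \<circ> s = y \<circ> w"
    using simple_cancel_right[OF s, of "y \<circ> w"] by (simp only: comp_assoc)
  have "coef (?g \<otimes>\<^bsub>H\<^esub> T s) (y \<circ> (w \<circ> s)) \<in> Units K"
    unfolding coef_mult_T_simple[OF s g yws] cancel zero using unit q_unit
    by (auto simp: R.minus_closed R.Units_closed)
  moreover have "\<exists>w'\<in>affine_perms r. v \<in> fin_coset r (y \<circ> w') \<and> (\<forall>j. \<bar>w' j - j\<bar> \<le> n + 1) \<and>
         (w' = w \<circ> s \<or> ext_length r w' < ext_length r (w \<circ> s))"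
    if v: "v \<in> affine_perms r" and ne: "coef (?g \<otimes>\<^bsub>H\<^esub> T s) v \<noteq> \<zero>" for v
  proof (cases "coef ?g v = \<zero>")
    case False
    then obtain w' where "w' \<in> affine_perms r" "v \<in> fin_coset r (y \<circ> w')" "\<And>j. \<bar>w' j - j\<bar> \<le> n"
      "w' = w \<or> ext_length r w' < ext_length r w"
      using supp[OF v] by blast
    moreover from this(3) have "\<bar>w' j - j\<bar> \<le> n + 1" for j by (smt (verit))
    ultimately show ?thesis using up by (intro bexI[of _ w']) auto
  next
    case True
    have vs: "v \<circ> s \<in> affine_perms r" using s v by (rule comp_simple_closed)
    have "coef ?g (v \<circ> s) \<noteq> \<zero>"
      using ne True unfolding coef_mult_T_simple[OF s g v] by (auto simp: R.minus_closed split: if_splits)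
    then obtain w' where w': "w' \<in> affine_perms r" "v \<circ> s \<in> fin_coset r (y \<circ> w')" "\<And>j. \<bar>w' j - j\<bar> \<le> n"
      "w' = w \<or> ext_length r w' < ext_length r w"
      using supp[OF vs] by blast
    have "v \<in> fin_coset r (y \<circ> (w' \<circ> s))"
      using w'(2) fin_coset_comp_simple_iff[OF s] by (simp only: comp_assoc)
    moreover have "\<bar>(w' \<circ> s) j - j\<bar> \<le> n + 1" for j
      using w'(3)[of "s j"] s_disp[of j] by (simp add: abs_if split: if_splits)
    moreover have "w' \<circ> s = w \<circ> s \<or> ext_length r (w' \<circ> s) < ext_length r (w \<circ> s)"
      using w'(4) ext_length_simple_right_le(1)[OF r_pos w'(1) s] up by auto
    ultimately show ?thesis using comp_simple_closed[OF s w'(1)] by blast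
  qed
  ultimately show ?thesis unfolding leading_term_def prod by blast
qed

text \<open>
  Induction along a reduced word, whose prefixes are again reduced.
\<close>

lemma leading_term_reduced:
  assumes t: "coset_sum y t" and y: "y \<in> affine_perms r"
    and sep: "\<And>w w'. \<lbrakk>\<And>j. \<bar>w j - j\<bar> \<le> N; \<And>j. \<bar>w' j - j\<bar> \<le> N;
          y \<circ> w \<in> fin_coset r (y \<circ> w')\<rbrakk> \<Longrightarrow> w = w'"
  shows "\<lbrakk>set ss \<subseteq> simple_reflections r; ext_length r (translation m \<circ> word ss) = length ss;
      \<bar>m\<bar> + int (length ss) \<le> N\<rbrakk> \<Longrightarrow>
     leading_term y t (\<bar>m\<bar> + int (length ss)) (translation m \<circ> word ss)"
proof (induction ss rule: rev_induct)
  case Nil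
  show ?case using leading_term_translation[OF t y, of m] by simp
next
  case (snoc s ss)
  have s: "s \<in> simple_reflections r" and ss: "set ss \<subseteq> simple_reflections r"
    using snoc.prems(1) by auto
  define w where "w = translation m \<circ> word ss"
  have eq: "translation m \<circ> word (ss @ [s]) = w \<circ> s"
    unfolding w_def word_append word_Cons word_Nil by (simp only: comp_assoc comp_id)
  have w: "w \<in> affine_perms r"
    unfolding w_def using translation_in_affine_perms word_in_affine_perms[OF ss] by (rule comp_in_affine_perms)
  have "ext_length r (translation m \<circ> word (ss @ [s])) = length (ss @ [s])" by (rule snoc.prems(2))
  then have len_ws: "ext_length r (w \<circ> s) = length ss + 1" unfolding eq by simp
  have len_w: "ext_length r w = length ss"
    using ext_length_le[OF r_pos ss, of m] ext_length_simple_right_le(1)[OF r_pos w s] len_ws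
    unfolding w_def[symmetric] by linarith
  have N: "\<bar>m\<bar> + int (length ss) + 1 \<le> N" using snoc.prems(3) by simp
  have lead: "leading_term y t (\<bar>m\<bar> + int (length ss)) w"
    unfolding w_def
  proof (rule snoc.IH[OF ss])
    show "ext_length r (translation m \<circ> word ss) = length ss" using len_w unfolding w_def .
    show "\<bar>m\<bar> + int (length ss) \<le> N" using N by simp
  qed
  have "leading_term y t (\<bar>m\<bar> + int (length ss) + 1) (w \<circ> s)"
  proof (rule leading_term_step[OF lead _ y w s])
    show "t \<in> carrier H" using t by (auto simp: coset_sum_def intro: sym_ideal_closed)
    show "ext_length r (w \<circ> s) = ext_length r w + 1" using len_ws len_w by simp
    show "\<bar>w j - j\<bar> \<le> \<bar>m\<bar> + int (length ss)" for j
      using word_displacement[OF ss, of j] by (simp add: w_def translation_def)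
    show "v = v'" if "\<And>j. \<bar>v j - j\<bar> \<le> \<bar>m\<bar> + int (length ss) + 1"
      "\<And>j. \<bar>v' j - j\<bar> \<le> \<bar>m\<bar> + int (length ss) + 1" "y \<circ> v \<in> fin_coset r (y \<circ> v')" for v v'
      by (rule sep) (use that N in \<open>auto intro: order_trans\<close>)
  qed
  moreover have "\<bar>m\<bar> + int (length (ss @ [s])) = \<bar>m\<bar> + int (length ss) + 1" by simp
  ultimately show ?case unfolding eq by (simp only:)
qed

lemma coef_mult_single:
  assumes t: "t \<in> carrier H" and h: "h \<in> carrier H" and v: "v \<in> affine_perms r" and z: "z \<in> support h"
    and others: "\<And>w. \<lbrakk>w \<in> support h; w \<noteq> z\<rbrakk> \<Longrightarrow> coef (t \<otimes>\<^bsub>H\<^esub> T w) v = \<zero>"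
  shows "coef (t \<otimes>\<^bsub>H\<^esub> h) v = coef h z \<otimes> coef (t \<otimes>\<^bsub>H\<^esub> T z) v"
proof -
  have zc: "coef h z \<otimes> coef (t \<otimes>\<^bsub>H\<^esub> T z) v \<in> carrier K"
    using t h v z by (simp add: T_closed)
  have "coef (t \<otimes>\<^bsub>H\<^esub> (\<Oplus>\<^bsub>H\<^esub>w\<in>A. coef h w \<odot>\<^bsub>H\<^esub> T w)) v =
      (if z \<in> A then coef h z \<otimes> coef (t \<otimes>\<^bsub>H\<^esub> T z) v else \<zero>)"
    if "finite A" "A \<subseteq> support h" for A
    using that
  proof induction
    case empty
    then show ?case using t v by (simp add: coef_zero)
  next
    case (insert x A)
    have xG: "x \<in> affine_perms r" using insert.prems by auto
    have closed: "(\<Oplus>\<^bsub>H\<^esub>w\<in>A. coef h w \<odot>\<^bsub>H\<^esub> T w) \<in> carrier H"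
      using h insert.prems by (intro finsum_closed) (auto simp: smult_closed T_closed)
    have "(\<Oplus>\<^bsub>H\<^esub>w\<in>insert x A. coef h w \<odot>\<^bsub>H\<^esub> T w) =
        coef h x \<odot>\<^bsub>H\<^esub> T x \<oplus>\<^bsub>H\<^esub> (\<Oplus>\<^bsub>H\<^esub>w\<in>A. coef h w \<odot>\<^bsub>H\<^esub> T w)"
      using h insert by (intro finsum_insert) (auto simp: smult_closed T_closed)
    then have "coef (t \<otimes>\<^bsub>H\<^esub> (\<Oplus>\<^bsub>H\<^esub>w\<in>insert x A. coef h w \<odot>\<^bsub>H\<^esub> T w)) v =
        coef h x \<otimes> coef (t \<otimes>\<^bsub>H\<^esub> T x) v \<oplus> coef (t \<otimes>\<^bsub>H\<^esub> (\<Oplus>\<^bsub>H\<^esub>w\<in>A. coef h w \<odot>\<^bsub>H\<^esub> T w)) v"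
      using t h v xG closed
      by (simp add: r_distr smult_mult_right smult_closed T_closed coef_add coef_smult)
    also have "\<dots> = coef h x \<otimes> coef (t \<otimes>\<^bsub>H\<^esub> T x) v \<oplus>
        (if z \<in> A then coef h z \<otimes> coef (t \<otimes>\<^bsub>H\<^esub> T z) v else \<zero>)"
      using insert by simp
    also have "\<dots> = (if z \<in> insert x A then coef h z \<otimes> coef (t \<otimes>\<^bsub>H\<^esub> T z) v else \<zero>)"
    proof (cases "x = z")
      case True
      then show ?thesis using insert.hyps zc by simp
    next
      case False
      then have "coef (t \<otimes>\<^bsub>H\<^esub> T x) v = \<zero>" using others insert.prems by simp
      then show ?thesis using False zc h xG by simp
    qed
    finally show ?case .
  qed
  from this[of "support h"] show ?thesis
    using coef_props(2,3)[OF h] z by auto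
qed

text \<open>
  Let \<open>z\<close> be longest in the support of \<open>h\<close>, and let \<open>y\<close> separate all elements whose displacement
  is within the bound coming from the support. By \<open>leading_term\<close> and separation no other \<open>T w\<close> in
  \<open>h\<close> contributes to the coefficient of \<open>t h\<close> at \<open>y \<circ> z\<close>, where \<open>t\<close> is the coset sum of
  \<open>y\<close>. So this coefficient is a unit times the coefficient of \<open>h\<close> at \<open>z\<close>.
\<close>

lemma sym_ideal_faithful:
  assumes h: "h \<in> carrier H" and ann: "\<And>t. t \<in> sym_ideal \<Longrightarrow> t \<otimes>\<^bsub>H\<^esub> h = \<zero>\<^bsub>H\<^esub>"
  shows "h = \<zero>\<^bsub>H\<^esub>"
proof (rule ccontr)
  assume "h \<noteq> \<zero>\<^bsub>H\<^esub>"
  then have ne: "support h \<noteq> {}"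
    using coef_props(3)[OF h] by (metis finsum_empty)
  have fin: "finite (support h)" using h by (rule coef_props(2))
  have "\<exists>p. set (snd p) \<subseteq> simple_reflections r \<and> w = translation (fst p) \<circ> word (snd p) \<and>
      length (snd p) = ext_length r w" if "w \<in> support h" for w
  proof -
    have "w \<in> affine_perms r" using that by simp
    then obtain k ts where "set ts \<subseteq> simple_reflections r" "w = translation k \<circ> word ts"
      "length ts = ext_length r w"
      by (rule reduced_factor[OF r_pos])
    then show ?thesis by (intro exI[of _ "(k, ts)"]) (simp only: fst_conv snd_conv simp_thms)
  qed
  then have "\<exists>p. \<forall>w\<in>support h. set (snd (p w)) \<subseteq> simple_reflections r \<and>
      w = translation (fst (p w)) \<circ> word (snd (p w)) \<and> length (snd (p w)) = ext_length r w"
    by (intro bchoice ballI)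
  then obtain p where p: "\<forall>w\<in>support h. set (snd (p w)) \<subseteq> simple_reflections r \<and>
      w = translation (fst (p w)) \<circ> word (snd (p w)) \<and> length (snd (p w)) = ext_length r w"
    by (rule exE)
  define m where "m = fst \<circ> p"
  define ss where "ss = snd \<circ> p"
  have ss: "\<And>w. w \<in> support h \<Longrightarrow> set (ss w) \<subseteq> simple_reflections r"
    and fact: "\<And>w. w \<in> support h \<Longrightarrow> w = translation (m w) \<circ> word (ss w)"
    and len: "\<And>w. w \<in> support h \<Longrightarrow> length (ss w) = ext_length r w"
    using p unfolding m_def ss_def comp_apply[of fst] comp_apply[of snd] by (blast dest: bspec)+
  \<comment> \<open>A displacement bound for the whole support, read off from reduced factorisations.\<close>
  define N where "N = Max ((\<lambda>w. \<bar>m w\<bar> + int (length (ss w))) ` support h)"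
  have N: "\<bar>m w\<bar> + int (length (ss w)) \<le> N" if "w \<in> support h" for w
    unfolding N_def using fin that by (intro Max_ge) auto
  define y where "y = spread r (2 * N + 1)"
  have y: "y \<in> affine_perms r" unfolding y_def by (rule spread_in_affine_perms)
  have sep: "w = w'" if "\<And>j. \<bar>w j - j\<bar> \<le> N" "\<And>j. \<bar>w' j - j\<bar> \<le> N" "y \<circ> w \<in> fin_coset r (y \<circ> w')" for w w'
    using spread_separates[OF r_pos that(1,2), of "2 * N + 1"] that(3) by (simp add: y_def)
  obtain t where t: "coset_sum y t" using y by (rule coset_sum_exists)
  have tJ: "t \<in> sym_ideal" using t by (simp add: coset_sum_def)
  have lead: "leading_term y t (\<bar>m w\<bar> + int (length (ss w))) w" if w: "w \<in> support h" for w
  proof -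
    have "leading_term y t (\<bar>m w\<bar> + int (length (ss w))) (translation (m w) \<circ> word (ss w))"
    proof (rule leading_term_reduced[OF t y _ ss[OF w] _ N[OF w]])
      show "v = v'" if "\<And>j. \<bar>v j - j\<bar> \<le> N" "\<And>j. \<bar>v' j - j\<bar> \<le> N" "y \<circ> v \<in> fin_coset r (y \<circ> v')" for v v'
        using that by (rule sep)
      show "ext_length r (translation (m w) \<circ> word (ss w)) = length (ss w)"
        using len[OF w] unfolding fact[OF w, symmetric] by (rule sym)
    qed
    then show ?thesis unfolding fact[OF w, symmetric] .
  qed
  have "Max (ext_length r ` support h) \<in> ext_length r ` support h"
    using fin ne by (intro Max_in) auto
  then obtain z where z: "z \<in> support h" and z_max: "ext_length r z = Max (ext_length r ` support h)"
    by auto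
  have max: "ext_length r w \<le> ext_length r z" if "w \<in> support h" for w
    unfolding z_max using fin that by (intro Max_ge) auto
  have zG: "z \<in> affine_perms r" using z by simp
  have yz: "y \<circ> z \<in> affine_perms r" using y zG by (rule comp_in_affine_perms)
  have z_disp: "\<bar>z j - j\<bar> \<le> N" for j
  proof -
    have "z j = word (ss z) j + m z" using fact[OF z] by (metis comp_apply translation_def)
    then show ?thesis using word_displacement[OF ss[OF z], of j] N[OF z] by linarith
  qed
  have "coef (t \<otimes>\<^bsub>H\<^esub> T w) (y \<circ> z) = \<zero>" if w: "w \<in> support h" and "w \<noteq> z" for w
  proof (rule ccontr)
    assume "coef (t \<otimes>\<^bsub>H\<^esub> T w) (y \<circ> z) \<noteq> \<zero>"
    then obtain w' where w': "y \<circ> z \<in> fin_coset r (y \<circ> w')"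
      "\<And>j. \<bar>w' j - j\<bar> \<le> \<bar>m w\<bar> + int (length (ss w))"
      "w' = w \<or> ext_length r w' < ext_length r w"
      using lead[OF w] yz unfolding leading_term_def by blast
    have "\<bar>w' j - j\<bar> \<le> N" for j using w'(2)[of j] N[OF w] by linarith
    then have "z = w'" using sep[OF z_disp _ w'(1)] by blast
    then show False using w'(3) max[OF w] \<open>w \<noteq> z\<close> by auto
  qed
  then have "coef (t \<otimes>\<^bsub>H\<^esub> h) (y \<circ> z) = coef h z \<otimes> coef (t \<otimes>\<^bsub>H\<^esub> T z) (y \<circ> z)"
    using coef_mult_single[OF sym_ideal_closed[OF tJ] h yz z] by blast
  then have "coef h z \<otimes> coef (t \<otimes>\<^bsub>H\<^esub> T z) (y \<circ> z) = \<zero>"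
    using ann[OF tJ] coef_zero[OF yz] by simp
  moreover have "coef (t \<otimes>\<^bsub>H\<^esub> T z) (y \<circ> z) \<in> Units K"
    using lead[OF z] by (simp add: leading_term_def)
  ultimately have "coef h z = \<zero>"
    using coef_closed[OF h zG]
    by (metis R.Units_closed R.Units_l_cancel R.m_comm R.r_null R.zero_closed)
  then show False using z by simp
qed

end

section \<open>The action on tensor space\<close>

text \<open>
  The composition \<open>(r, 0, \<dots>, 0)\<close>, extended periodically.
\<close>

definition one_row :: "nat \<Rightarrow> nat \<Rightarrow> int \<Rightarrow> nat" where
  "one_row n r i = (if i mod int n = 1 mod int n then r else 0)"

lemma one_row_eq:
  assumes "i \<in> {1..int n}"
  shows "one_row n r i = (if i = 1 then r else 0)"
proof -
  have "i mod int n = 1 mod int n \<longleftrightarrow> i = 1"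
  proof
    assume eq: "i mod int n = 1 mod int n"
    then have "int n dvd i - 1" by (simp add: mod_eq_dvd_iff)
    then show "i = 1" using assms zdvd_not_zless[of "i - 1" "int n"] by force
  qed simp
  then show ?thesis by (simp add: one_row_def)
qed

lemma sum_one_row:
  assumes "A \<subseteq> {1..int n}"
  shows "(\<Sum>j\<in>A. one_row n r j) = (if 1 \<in> A then r else 0)"
proof -
  have "finite A" using assms by (rule finite_subset) simp
  have "(\<Sum>j\<in>A. one_row n r j) = (\<Sum>j\<in>A. if j = 1 then r else 0)"
    using assms by (intro sum.cong refl one_row_eq) auto
  then show ?thesis using \<open>finite A\<close> by simp
qed

lemma one_row_in_compositions: "1 \<le> n \<Longrightarrow> one_row n r \<in> compositions n r"
  using sum_one_row[of "{1..int n}" n r] by (simp add: compositions_def) (simp add: one_row_def)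

lemma block_one_row:
  assumes "i \<in> {1..int n}"
  shows "block (one_row n r) i = (if i = 1 then {1..int r} else {})"
proof -
  have "(\<Sum>j\<in>{1..<i}. one_row n r j) = (if i = 1 then 0 else r)"
    using assms by (subst sum_one_row) auto
  moreover have "(\<Sum>j\<in>{1..i}. one_row n r j) = r"
    using assms by (subst sum_one_row) auto
  ultimately show ?thesis unfolding block_def by auto
qed

lemma young_subgroup_one_row: "young_subgroup n r (one_row n r) = fin_sym r"
  by (auto simp: young_subgroup_def block_one_row fin_sym_def split: if_splits)

context affine_hecke_unit
begin

lemma x_elt_one_row: "x_elt H T n r (one_row n r) = sym_sum"
  by (simp add: x_elt_def sym_sum_def young_subgroup_one_row)

lemma x_elt_closed: "x_elt H T n r \<mu> \<in> carrier H"
  unfolding x_elt_def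
  by (intro finsum_closed) (auto simp: young_subgroup_def intro: T_closed fin_sym_subset)

lemma tensor_space_component:
  assumes "t \<in> carrier (tensor_space H T n r)" "\<mu> \<in> compositions n r"
  obtains g where "g \<in> carrier H" "t \<mu> = x_elt H T n r \<mu> \<otimes>\<^bsub>H\<^esub> g"
  using assms by (auto simp: tensor_space_def dest!: PiE_mem)

lemma tensor_space_component_closed:
  assumes "t \<in> carrier (tensor_space H T n r)" "\<mu> \<in> compositions n r"
  shows "t \<mu> \<in> carrier H"
proof -
  obtain g where "g \<in> carrier H" "t \<mu> = x_elt H T n r \<mu> \<otimes>\<^bsub>H\<^esub> g"
    using assms by (rule tensor_space_component)
  then show ?thesis using m_closed[OF x_elt_closed] by metis
qed

lemma right_action_closed:
  assumes "h \<in> carrier H" "t \<in> carrier (tensor_space H T n r)"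
  shows "right_action H n r h t \<in> carrier (tensor_space H T n r)"
proof -
  have "\<exists>g. t \<mu> \<otimes>\<^bsub>H\<^esub> h = x_elt H T n r \<mu> \<otimes>\<^bsub>H\<^esub> g \<and> g \<in> carrier H" if \<mu>: "\<mu> \<in> compositions n r" for \<mu>
  proof -
    obtain g where g: "g \<in> carrier H" "t \<mu> = x_elt H T n r \<mu> \<otimes>\<^bsub>H\<^esub> g"
      using assms(2) \<mu> by (rule tensor_space_component)
    then show ?thesis using assms(1) x_elt_closed
      by (intro exI[of _ "g \<otimes>\<^bsub>H\<^esub> h"]) (simp add: m_assoc)
  qed
  then show ?thesis by (auto simp: tensor_space_def right_action_def)
qed

lemma tensor_space_add_closed:
  assumes "s \<in> carrier (tensor_space H T n r)" "t \<in> carrier (tensor_space H T n r)"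
  shows "s \<oplus>\<^bsub>tensor_space H T n r\<^esub> t \<in> carrier (tensor_space H T n r)"
proof -
  have "\<exists>g. s \<mu> \<oplus>\<^bsub>H\<^esub> t \<mu> = x_elt H T n r \<mu> \<otimes>\<^bsub>H\<^esub> g \<and> g \<in> carrier H" if \<mu>: "\<mu> \<in> compositions n r" for \<mu>
  proof -
    obtain g where g: "g \<in> carrier H" "s \<mu> = x_elt H T n r \<mu> \<otimes>\<^bsub>H\<^esub> g"
      using assms(1) \<mu> by (rule tensor_space_component)
    obtain h where h: "h \<in> carrier H" "t \<mu> = x_elt H T n r \<mu> \<otimes>\<^bsub>H\<^esub> h"
      using assms(2) \<mu> by (rule tensor_space_component)
    show ?thesis using g h x_elt_closed
      by (intro exI[of _ "g \<oplus>\<^bsub>H\<^esub> h"]) (simp add: r_distr)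
  qed
  then show ?thesis by (auto simp: tensor_space_def)
qed

lemma xi_apply:
  "t \<in> carrier (tensor_space H T n r) \<Longrightarrow> xi H T n r h t = right_action H n r h t"
  by (simp add: xi_def)

lemma xi_in_End_schur:
  assumes h: "h \<in> carrier H"
  shows "xi H T n r h \<in> carrier (End_schur H T n r)"
proof -
  let ?M = "tensor_space H T n r"
  have "xi H T n r h \<in> hom (add_monoid ?M) (add_monoid ?M)"
  proof (rule homI)
    fix s t assume "s \<in> carrier (add_monoid ?M)" "t \<in> carrier (add_monoid ?M)"
    then have s: "s \<in> carrier ?M" and t: "t \<in> carrier ?M" by simp_all
    show "xi H T n r h s \<in> carrier (add_monoid ?M)"
      using right_action_closed[OF h s] by (simp add: xi_apply[OF s])
    have "right_action H n r h (s \<oplus>\<^bsub>?M\<^esub> t) = right_action H n r h s \<oplus>\<^bsub>?M\<^esub> right_action H n r h t"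
      using tensor_space_component_closed[OF s] tensor_space_component_closed[OF t] h
      by (auto simp: right_action_def tensor_space_def fun_eq_iff l_distr)
    then show "xi H T n r h (s \<otimes>\<^bsub>add_monoid ?M\<^esub> t) = xi H T n r h s \<otimes>\<^bsub>add_monoid ?M\<^esub> xi H T n r h t"
      by (simp add: xi_apply s t tensor_space_add_closed)
  qed
  moreover have "xi H T n r h \<in> extensional (carrier ?M)" by (simp add: xi_def)
  moreover have "xi H T n r h (f t) = f (xi H T n r h t)"
    if f: "f \<in> carrier (schur_algebra H T n r)" and t: "t \<in> carrier ?M" for f t
  proof -
    have "f t \<in> carrier ?M" and "f (right_action H n r h t) = right_action H n r h (f t)"
      using f t h by (auto simp: schur_algebra_def endo_algebra_def hom_def)
    then show ?thesis using t by (simp add: xi_apply)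
  qed
  ultimately show ?thesis by (simp add: End_schur_def endo_algebra_def)
qed

lemma xi_eqI:
  assumes "\<And>t. t \<in> carrier (tensor_space H T n r) \<Longrightarrow> xi H T n r h t = f t"
    and "f \<in> extensional (carrier (tensor_space H T n r))"
  shows "xi H T n r h = f"
  using assms by (intro extensionalityI[of _ "carrier (tensor_space H T n r)"]) (auto simp: xi_def)

lemma xi_algebra_hom: "xi H T n r \<in> algebra_hom K H (opposite (End_schur H T n r))"
proof -
  let ?M = "tensor_space H T n r" and ?E = "opposite (End_schur H T n r)"
  have carrier: "carrier ?E = carrier (End_schur H T n r)"
    and mult: "f \<otimes>\<^bsub>?E\<^esub> g = compose (carrier ?M) g f"
    and add: "f \<oplus>\<^bsub>?E\<^esub> g = (\<lambda>t\<in>carrier ?M. f t \<oplus>\<^bsub>?M\<^esub> g t)"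
    and one: "\<one>\<^bsub>?E\<^esub> = (\<lambda>t\<in>carrier ?M. t)"
    and smult: "a \<odot>\<^bsub>?E\<^esub> f = (\<lambda>t\<in>carrier ?M. a \<odot>\<^bsub>?M\<^esub> f t)" for f g a
    by (simp_all add: opposite_def End_schur_def endo_algebra_def)
  have ext: "t \<mu> = undefined" if "t \<in> carrier ?M" "\<mu> \<notin> compositions n r" for t \<mu>
    using that unfolding tensor_space_def partial_object.select_convs by (rule PiE_arb)
  have "xi H T n r \<in> ring_hom H ?E"
  proof (rule ring_hom_memI)
    fix g h assume g: "g \<in> carrier H" and h: "h \<in> carrier H"
    show "xi H T n r g \<in> carrier ?E" unfolding carrier using g by (rule xi_in_End_schur)
    show "xi H T n r (g \<otimes>\<^bsub>H\<^esub> h) = xi H T n r g \<otimes>\<^bsub>?E\<^esub> xi H T n r h"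
      unfolding mult
    proof (rule xi_eqI)
      fix t assume t: "t \<in> carrier ?M"
      have "right_action H n r (g \<otimes>\<^bsub>H\<^esub> h) t = right_action H n r h (right_action H n r g t)"
        using tensor_space_component_closed[OF t] g h
        by (auto simp: right_action_def fun_eq_iff m_assoc)
      then show "xi H T n r (g \<otimes>\<^bsub>H\<^esub> h) t = compose (carrier ?M) (xi H T n r h) (xi H T n r g) t"
        using t right_action_closed[OF g t] by (simp add: compose_def xi_apply)
    qed (simp add: compose_def)
    show "xi H T n r (g \<oplus>\<^bsub>H\<^esub> h) = xi H T n r g \<oplus>\<^bsub>?E\<^esub> xi H T n r h"
      unfolding add
    proof (rule xi_eqI)
      fix t assume t: "t \<in> carrier ?M"
      have "right_action H n r (g \<oplus>\<^bsub>H\<^esub> h) t = right_action H n r g t \<oplus>\<^bsub>?M\<^esub> right_action H n r h t"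
        using tensor_space_component_closed[OF t] g h
        by (auto simp: right_action_def tensor_space_def fun_eq_iff r_distr)
      then show "xi H T n r (g \<oplus>\<^bsub>H\<^esub> h) t = (\<lambda>t\<in>carrier ?M. xi H T n r g t \<oplus>\<^bsub>?M\<^esub> xi H T n r h t) t"
        using t by (simp add: xi_apply)
    qed simp
  next
    show "xi H T n r \<one>\<^bsub>H\<^esub> = \<one>\<^bsub>?E\<^esub>"
      unfolding one
    proof (rule xi_eqI)
      fix t assume t: "t \<in> carrier ?M"
      have "right_action H n r \<one>\<^bsub>H\<^esub> t = t"
        using tensor_space_component_closed[OF t] ext[OF t]
        by (auto simp: right_action_def fun_eq_iff)
      then show "xi H T n r \<one>\<^bsub>H\<^esub> t = (\<lambda>t\<in>carrier ?M. t) t" using t by (simp add: xi_apply)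
    qed simp
  qed
  moreover have "xi H T n r (a \<odot>\<^bsub>H\<^esub> h) = a \<odot>\<^bsub>?E\<^esub> xi H T n r h" if a: "a \<in> carrier K" and h: "h \<in> carrier H" for a h
    unfolding smult
  proof (rule xi_eqI)
    fix t assume t: "t \<in> carrier ?M"
    have "right_action H n r (a \<odot>\<^bsub>H\<^esub> h) t = a \<odot>\<^bsub>?M\<^esub> right_action H n r h t"
      using tensor_space_component_closed[OF t] a h
      by (auto simp: right_action_def tensor_space_def fun_eq_iff smult_mult_right)
    then show "xi H T n r (a \<odot>\<^bsub>H\<^esub> h) t = (\<lambda>t\<in>carrier ?M. a \<odot>\<^bsub>?M\<^esub> xi H T n r h t) t"
      using t by (simp add: xi_apply)
  qed simp
  ultimately show ?thesis by (simp add: algebra_hom_def)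
qed

text \<open>
  The difference of two elements with the same image annihilates every component of
  tensor space, in particular the one at \<open>one_row n r\<close>, which is \<open>sym_ideal\<close>.
\<close>

lemma xi_inj_on:
  assumes n: "1 \<le> n"
  shows "inj_on (xi H T n r) (carrier H)"
proof (rule inj_onI)
  fix g h assume g: "g \<in> carrier H" and h: "h \<in> carrier H" and eq: "xi H T n r g = xi H T n r h"
  have \<mu>: "one_row n r \<in> compositions n r" using n by (rule one_row_in_compositions)
  have "g \<ominus>\<^bsub>H\<^esub> h = \<zero>\<^bsub>H\<^esub>"
  proof (rule sym_ideal_faithful)
    show "g \<ominus>\<^bsub>H\<^esub> h \<in> carrier H" using g h by simp
    fix t assume t: "t \<in> sym_ideal"
    \<comment> \<open>Any members of the summands will do as remaining components.\<close>
    define t' where "t' = (\<lambda>\<nu>\<in>compositions n r. if \<nu> = one_row n r then t else x_elt H T n r \<nu>)"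
    have t': "t' \<in> carrier (tensor_space H T n r)"
    proof -
      have "(if \<nu> = one_row n r then t else x_elt H T n r \<nu>)
          \<in> {x_elt H T n r \<nu> \<otimes>\<^bsub>H\<^esub> g | g. g \<in> carrier H}" for \<nu>
      proof (cases "\<nu> = one_row n r")
        case True
        then show ?thesis using t by (simp add: sym_ideal_def x_elt_one_row)
      next
        case False
        have "x_elt H T n r \<nu> = x_elt H T n r \<nu> \<otimes>\<^bsub>H\<^esub> \<one>\<^bsub>H\<^esub>" by (simp add: x_elt_closed)
        then show ?thesis using False one_closed by auto
      qed
      then show ?thesis
        unfolding t'_def tensor_space_def partial_object.select_convs restrict_PiE_iff by blast
    qed
    have "right_action H n r g t' (one_row n r) = right_action H n r h t' (one_row n r)"
      using eq xi_apply[OF t'] by metis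
    then have "t \<otimes>\<^bsub>H\<^esub> g = t \<otimes>\<^bsub>H\<^esub> h" using \<mu> by (simp add: right_action_def t'_def)
    then show "t \<otimes>\<^bsub>H\<^esub> (g \<ominus>\<^bsub>H\<^esub> h) = \<zero>\<^bsub>H\<^esub>"
      using sym_ideal_closed[OF t] g h by (simp add: minus_eq r_distr r_minus r_neg)
  qed
  then show "g = h" using g h by (simp add: r_right_minus_eq)
qed

end

theorem theorem3p5:
  fixes K :: "('a, 'k) ring_scheme"
    and H :: "('a, 'h, 'l) module_scheme"
    and \<epsilon> :: 'a
    and T :: "(int \<Rightarrow> int) \<Rightarrow> 'h"
    and n r :: nat
  assumes "1 \<le> n" and "1 \<le> r"
    and "cring K" and "\<epsilon> \<in> Units K"
    and "ext_affine_hecke K H \<epsilon> r T"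
  shows "xi H T n r \<in> algebra_hom K H (opposite (End_schur H T n r)) \<and>
         inj_on (xi H T n r) (carrier H)"
proof -
  interpret affine_hecke_unit K H \<epsilon> r T
    using assms by (intro affine_hecke_unit.intro affine_hecke_unit_axioms.intro)
  show ?thesis using xi_algebra_hom xi_inj_on[OF assms(1)] by blast
qed

end
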